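(* Let $\kappa,H:\mathbb{T}\to\mathbb{R}$ be bounded functions that are also bounded away from zero, with $H$ positive. Then the equation $$\kappa^2u-D^+_V(H\,D^-_Wu)=\dot B_W$$ on $H_{W,V,\mathcal{D}}(\mathbb{T})$ has, almost surely, a unique (weak) solution, with càdlàg sample paths. That is, almost surely there is exactly one $u\in H_{W,V,\mathcal{D}}(\mathbb{T})$ such that $$\int_{\mathbb{T}}\kappa^2ug\,dV+\int_{\mathbb{T}}H\,D^-_Wu\,D^-_Wg\,dW=\dot B_W(g)\qquad\text{for all }g\in H_{W,V,\mathcal{D}}(\mathbb{T}),$$ and $u$ has càdlàg sample paths.
   Context: Notation. $\mathbb{T}=\mathbb{R}/\mathbb{Z}$, with a tagged point $0$ and identified with $[0,1)$; càdlàg means right-continuous with left limits, càglàd means left-continuous with right limits. $W,V:\mathbb{R}\to\mathbb{R}$ are strictly increasing, $W$ is càdlàg, $V$ is càglàd, and $W(x+1)-W(x)=W(1)-W(0)$, $V(x+1)-V(x)=V(1)-V(0)$ for all $x$; both are continuous at $0$ and $W(0)=V(0)=0$. No further continuity is assumed. $dW$, $dV$ are the induced finite Borel measures on $\mathbb{T}$, with $dW((a,b])=W(b)-W(a)$ and $dV([a,b))=V(b)-V(a)$; $L^2_W(\mathbb{T}),L^2_V(\mathbb{T})$ are the corresponding $L^2$ spaces, and $L^2_{W,0}(\mathbb{T})=\{F\in L^2_W(\mathbb{T}):\int_{\mathbb{T}}F\,dW=0\}$. The lateral derivatives are $D^-_Wf(x)=\lim_{h\to0^-}\frac{f(x+h)-f(x)}{W(x+h)-W(x)}$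 and $D^+_Vg(x)=\lim_{h\to0^+}\frac{g(x+h)-g(x)}{V(x+h)-V(x)}$. $H_{W,V}(\mathbb{T})$ is the energetic space of $I-D^+_VD^-_W$ on $L^2_V(\mathbb{T})$; concretely it is the set of $f\in L^2_V(\mathbb{T})$ of the form $f(x)=c+\int_{(0,x]}F\,dW$ ($V$-a.e.) with $c\in\mathbb{R}$ and $F\in L^2_{W,0}(\mathbb{T})$; $F$ is unique and denoted $D^-_Wf$, and $f$ is identified with the càdlàg representative given by this formula. $H_{W,V,\mathcal{D}}(\mathbb{T})=\{f\in H_{W,V}(\mathbb{T}):f(0)=0\}$, a Hilbert space with inner product $\int_{\mathbb{T}}D^-_WfD^-_Wg\,dW$; $H^{-1}_{W,V,\mathcal{D}}(\mathbb{T})$ is its dual. A $W$-Brownian motion $B_W$ is a process on $[0,1]$ (restricted here to $[0,1)\cong\mathbb{T}$) such that: $B_W(0)=0$ a.s.; for $t>s$, $B_W(t)-B_W(s)$ is independent of $\sigma(B_W(u):u\le s)$ and has $N(0,W(t)-W(s))$ distribution; and $B_W$ has càdlàg sample paths. The pathwise $W$-Gaussian white noise is the (almost surely bounded) linear functional $\dot B_W\in H^{-1}_{W,V,\mathcal{D}}(\mathbb{T})$, $$\dot B_W(g)=-\int_{\mathbb{T}}B_W(s-)\,D^-_Wg(s)\,dW(s).$$ The functions $\kappa,H$ are Borel measurable; bounded away from zero means bounded below by a positive constant. A weak solution of the equation is $u\in H_{W,V,\mathcal{D}}(\mathbb{T})$ satisfying the displayed identity for all $g\in H_{W,V,\mathcal{D}}(\mathbb{T})$.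 *)

theory Defs
  imports "HOL-Probability.Probability" "HOL-Library.Periodic_Fun"
begin

text \<open>
  The torus \<open>\<real>/\<int>\<close> is identified with \<open>[0,1)\<close>. Functions on the torus are 1-periodic
  functions on \<open>\<real>\<close> (\<open>periodic_fun_simple'\<close>); measures and integrals on the torus live
  on the space \<open>{0..<1}\<close>.
\<close>

definition cadlag_on :: "real set \<Rightarrow> (real \<Rightarrow> real) \<Rightarrow> bool" where
  "cadlag_on S f \<longleftrightarrow>
     (\<forall>t\<in>S. (f \<longlongrightarrow> f t) (at t within S \<inter> {t<..}) \<and>
            (\<exists>l. (f \<longlongrightarrow> l) (at t within S \<inter> {..<t})))"

definition caglad_on :: "real set \<Rightarrow> (real \<Rightarrow> real) \<Rightarrow> bool" where
  "caglad_on S f \<longleftrightarrow>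
     (\<forall>t\<in>S. (f \<longlongrightarrow> f t) (at t within S \<inter> {..<t}) \<and>
            (\<exists>l. (f \<longlongrightarrow> l) (at t within S \<inter> {t<..})))"

definition bounded_away_from_zero :: "(real \<Rightarrow> real) \<Rightarrow> bool" where
  "bounded_away_from_zero f \<longleftrightarrow> (\<exists>c>0. \<forall>x. c \<le> \<bar>f x\<bar>)"

definition dW :: "(real \<Rightarrow> real) \<Rightarrow> real measure" where
  "dW W = restrict_space (interval_measure W) {0..<1}"

text \<open>
  \<open>interval_measure\<close> expects a right-continuous function. For left-continuous \<open>V\<close> the
  function \<open>x \<mapsto> - V (- x)\<close> is right-continuous, and reflecting its measure gives the one with
  \<open>[a,b) \<mapsto> V b - V a\<close>; see \<open>emeasure_dV\<close> below.
\<close>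

definition dV :: "(real \<Rightarrow> real) \<Rightarrow> real measure" where
  "dV V = restrict_space (distr (interval_measure (\<lambda>x. - V (- x))) borel uminus) {0..<1}"

lemma emeasure_dW:
  assumes "strict_mono W" "cadlag_on UNIV W" "0 \<le> a" "a \<le> b" "b < 1"
  shows "emeasure (dW W) {a<..b} = ennreal (W b - W a)"
proof -
  have "emeasure (dW W) {a<..b} = emeasure (interval_measure W) {a<..b}"
    unfolding dW_def using assms by (intro emeasure_restrict_space) auto
  also have "\<dots> = ennreal (W b - W a)"
    using assms
    by (intro emeasure_interval_measure_Ioc)
       (auto simp: cadlag_on_def continuous_within strict_mono_less_eq)
  finally show ?thesis .
qed

lemma emeasure_dV:
  assumes "strict_mono V" "caglad_on UNIV V" "0 \<le> a" "a \<le> b" "b \<le> 1"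
  shows "emeasure (dV V) {a..<b} = ennreal (V b - V a)"
proof -
  let ?G = "\<lambda>x. - V (- x)"
  have right: "continuous (at_right x) ?G" for x
  proof -
    have "(V \<longlongrightarrow> V (- x)) (at_left (- x))"
      using assms(2) by (simp add: caglad_on_def)
    then have "((\<lambda>y. V (- y)) \<longlongrightarrow> V (- x)) (at_right x)"
      by (simp add: filterlim_at_left_to_right)
    then show ?thesis
      by (simp add: continuous_within tendsto_minus)
  qed
  have "emeasure (dV V) {a..<b} =
      emeasure (distr (interval_measure ?G) borel uminus) {a..<b}"
    unfolding dV_def using assms by (intro emeasure_restrict_space) auto
  also have "\<dots> = emeasure (interval_measure ?G) (uminus -` {a..<b})"
    by (subst emeasure_distr) auto
  also have "uminus -` {a..<b} = {- b<..- a}"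
    by auto
  also have "emeasure (interval_measure ?G) \<dots> = ennreal (V b - V a)"
    using assms right
    by (subst emeasure_interval_measure_Ioc) (auto simp: strict_mono_less_eq)
  finally show ?thesis .
qed

text \<open>Square-integrable functions; elements equal almost everywhere are not identified.\<close>

definition L2 :: "real measure \<Rightarrow> (real \<Rightarrow> real) set" where
  "L2 M = {F \<in> borel_measurable M. integrable M (\<lambda>x. (F x)\<^sup>2)}"

definition L2W0 :: "(real \<Rightarrow> real) \<Rightarrow> (real \<Rightarrow> real) set" where
  "L2W0 W = {F \<in> L2 (dW W). (LINT x|dW W. F x) = 0}"

definition has_W_deriv :: "(real \<Rightarrow> real) \<Rightarrow> (real \<Rightarrow> real) \<Rightarrow> (real \<Rightarrow> real) \<Rightarrow> bool" where
  "has_W_deriv W f F \<longleftrightarrow>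
     F \<in> L2W0 W \<and> (\<exists>c. \<forall>x\<in>{0..<1}. f x = c + (LINT s:{0<..x}|dW W. F s))"

text \<open>
  Membership is stated for the cadlag representative, which satisfies the integral formula
  everywhere, not only almost everywhere with respect to \<open>dV\<close>.
\<close>

definition HWV :: "(real \<Rightarrow> real) \<Rightarrow> (real \<Rightarrow> real) \<Rightarrow> (real \<Rightarrow> real) set" where
  "HWV W V = {f. periodic_fun_simple' f \<and> f \<in> L2 (dV V) \<and> (\<exists>F. has_W_deriv W f F)}"

text \<open>
  \<open>D\<^sup>-\<^sub>W f\<close> is determined up to \<open>dW\<close>-null sets only; \<open>SOME\<close> picks a representative, and it is
  only ever used under integrals with respect to \<open>dW\<close>.
\<close>

definition DW :: "(real \<Rightarrow> real) \<Rightarrow> (real \<Rightarrow> real) \<Rightarrow> real \<Rightarrow> real" where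
  "DW W f = (SOME F. has_W_deriv W f F)"

definition HWVD :: "(real \<Rightarrow> real) \<Rightarrow> (real \<Rightarrow> real) \<Rightarrow> (real \<Rightarrow> real) set" where
  "HWVD W V = {f \<in> HWV W V. f 0 = 0}"

definition W_brownian_motion ::
    "'a measure \<Rightarrow> (real \<Rightarrow> real) \<Rightarrow> (real \<Rightarrow> 'a \<Rightarrow> real) \<Rightarrow> bool" where
  "W_brownian_motion M W B \<longleftrightarrow>
     prob_space M \<and>
     (\<forall>t\<in>{0..1}. B t \<in> borel_measurable M) \<and>
     (AE \<omega> in M. B 0 \<omega> = 0) \<and>
     (\<forall>s t. 0 \<le> s \<and> s < t \<and> t \<le> 1 \<longrightarrow>
        prob_space.indep_set M
          (sets (vimage_algebra (space M) (\<lambda>\<omega>. B t \<omega> - B s \<omega>) borel))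
          (sigma_sets (space M)
            (\<Union>u\<in>{0..s}. sets (vimage_algebra (space M) (B u) borel))) \<and>
        distributed M lborel (\<lambda>\<omega>. B t \<omega> - B s \<omega>) (normal_density 0 (sqrt (W t - W s)))) \<and>
     (\<forall>\<omega>\<in>space M. cadlag_on {0..1} (\<lambda>t. B t \<omega>))"

text \<open>
  For a path \<open>b\<close>, \<open>b(s-)\<close> is the left limit. At \<open>s = 0\<close> it is an arbitrary value, which is
  harmless since \<open>dW {0} = 0\<close> when \<open>W\<close> is continuous at \<open>0\<close>.
\<close>

definition white_noise :: "(real \<Rightarrow> real) \<Rightarrow> (real \<Rightarrow> real) \<Rightarrow> (real \<Rightarrow> real) \<Rightarrow> real" where
  "white_noise W b g = - (LINT s|dW W. Lim (at_left s) b * DW W g s)"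

definition weak_solution ::
    "(real \<Rightarrow> real) \<Rightarrow> (real \<Rightarrow> real) \<Rightarrow> (real \<Rightarrow> real) \<Rightarrow> (real \<Rightarrow> real) \<Rightarrow>
     ((real \<Rightarrow> real) \<Rightarrow> real) \<Rightarrow> (real \<Rightarrow> real) \<Rightarrow> bool" where
  "weak_solution W V \<kappa> H \<phi> u \<longleftrightarrow>
     u \<in> HWVD W V \<and>
     (\<forall>g\<in>HWVD W V.
        (LINT x|dV V. (\<kappa> x)\<^sup>2 * u x * g x) + (LINT x|dW W. H x * DW W u x * DW W g x) = \<phi> g)"

end

theory Submission
  imports Defs
begin

text \<open>
  The argument is pathwise: a cadlag path is bounded on \<open>[0,1]\<close>, so its left-limit function
  \<open>\<beta>(s) = B\<^sub>W(s-)\<close> is a bounded measurable function, and the white noise is the functional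
  \<open>g \<mapsto> - \<integral> \<beta> D\<^sub>W g dW\<close>.
  
  Uniqueness is the energy identity. If \<open>u\<close> and \<open>v\<close> are solutions, testing both equations with
  \<open>u\<close> and with \<open>v\<close> and combining the four identities gives
  \<open>\<integral> \<kappa>\<^sup>2 (u - v)\<^sup>2 dV + \<integral> H (D\<^sub>W u - D\<^sub>W v)\<^sup>2 dW = 0\<close>. As \<open>H > 0\<close>, the \<open>W\<close>-derivatives agree
  almost everywhere, and \<open>u\<close> and \<open>v\<close> are the primitives of these derivatives.
  
  Existence does not go through the Lax-Milgram theorem, but through an explicit first integral of
  the equation. Write \<open>u(x) = \<integral>\<^bsub>(0,x]\<^esub> F dW\<close> and \<open>g(x) = \<integral>\<^bsub>(0,x]\<^esub> G dW\<close>. By Fubini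
  (\<open>integral_mult_primitive\<close>) the zero order term is the integral of \<open>G(s) \<integral>\<^bsub>[s,1)\<^esub> \<kappa>\<^sup>2 u dV\<close> with
  respect to \<open>dW(s)\<close>, and as \<open>G\<close> ranges over the functions of mean zero, the weak equation says
  exactly that \<open>H F + \<beta> - \<integral>\<^bsub>[0,s)\<^esub> \<kappa>\<^sup>2 u dV\<close> is a constant \<open>a\<close>. For fixed \<open>a\<close> this is a Volterra
  system for \<open>(u, F)\<close>: \<open>F(s) = (a - \<beta>(s) + \<integral>\<^bsub>[0,s)\<^esub> \<kappa>\<^sup>2 u dV) / H(s)\<close> and
  \<open>u(x) = \<integral>\<^bsub>(0,x]\<^esub> F dW\<close>. It is solvable for every bounded right-hand side (\<open>Volterra_system\<close>), and
  its solution is affine in \<open>a\<close>: \<open>F = F\<^sub>0 + a F\<^sub>1\<close>, where \<open>F\<^sub>1\<close> belongs to the right-hand side \<open>1\<close>.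
  Since the system preserves positivity, \<open>F\<^sub>1 \<ge> 1/H\<close>, so \<open>\<integral> F\<^sub>1 dW > 0\<close> and \<open>a\<close> can be chosen with
  \<open>\<integral> F dW = 0\<close>, which is the periodicity condition.
  
  The Volterra system is solved by a Neumann series (\<open>Neumann_series\<close>). Its kernel is bounded by a
  multiple of the indicator of \<open>y < x\<close>. The strict inequality is what makes atoms of \<open>dV\<close> manageable:
  \<open>\<integral>\<^bsub>[0,x)\<^esub> exp (l V) dV \<le> exp (l V(x)) / l\<close> holds even where \<open>V\<close> jumps (\<open>exp_weight_dV\<close>), and
  the integral operator is a contraction in the sup norm weighted by \<open>exp (- l V)\<close> once \<open>l\<close> is large.
  
  Finally, any primitive of an integrable function with respect to the finite measure \<open>dW\<close> is
  cadlag, and so is its periodic extension (\<open>periodic_primitive_cadlag\<close>).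
\<close>

section \<open>Finite measures on the torus\<close>

locale torus_measure = finite_measure M for M :: "real measure" +
  assumes space_torus: "space M = {0..<1}"
    and sets_torus: "sets M = sets (restrict_space borel {0..<1})"
begin

lemma borel_imp_measurable: "f \<in> borel_measurable borel \<Longrightarrow> f \<in> borel_measurable M"
  using measurable_restrict_space1[of f borel borel "{0..<1}"]
    measurable_cong_sets[OF sets_torus refl] by blast

lemma ident_measurable [measurable]: "(\<lambda>x. x) \<in> borel_measurable M"
  by (rule borel_imp_measurable) simp

lemma integrable_bounded:
  fixes f :: "real \<Rightarrow> real"
  assumes "f \<in> borel_measurable M" "\<And>x. x \<in> space M \<Longrightarrow> \<bar>f x\<bar> \<le> C"
  shows "integrable M f"
  by (rule integrable_const_bound[of _ C]) (use assms in auto)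

lemma L2_integrable:
  assumes "f \<in> L2 M"
  shows "integrable M f"
proof -
  have [measurable]: "f \<in> borel_measurable M" and sq: "integrable M (\<lambda>x. (f x)\<^sup>2)"
    using assms by (auto simp: L2_def)
  show ?thesis
    by (rule square_integrable_imp_integrable[OF _ sq]) auto
qed

lemma L2_mult_integrable:
  assumes "f \<in> L2 M" "g \<in> L2 M"
  shows "integrable M (\<lambda>x. f x * g x)"
proof (rule Bochner_Integration.integrable_bound)
  show "integrable M (\<lambda>x. (f x)\<^sup>2 + (g x)\<^sup>2)"
    using assms by (auto simp: L2_def)
  show "(\<lambda>x. f x * g x) \<in> borel_measurable M"
    using assms by (auto simp: L2_def)
  have "\<bar>a * b\<bar> \<le> a\<^sup>2 + b\<^sup>2" for a b :: real
  proof -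
    have "2 * (\<bar>a\<bar> * \<bar>b\<bar>) \<le> a\<^sup>2 + b\<^sup>2"
      using sum_squares_bound[of "\<bar>a\<bar>" "\<bar>b\<bar>"] by simp
    moreover have "0 \<le> \<bar>a\<bar> * \<bar>b\<bar>" by simp
    ultimately show ?thesis unfolding abs_mult by linarith
  qed
  then show "AE x in M. norm (f x * g x) \<le> norm ((f x)\<^sup>2 + (g x)\<^sup>2)" by simp
qed

lemma bounded_imp_L2:
  assumes "f \<in> borel_measurable M" "\<And>x. x \<in> space M \<Longrightarrow> \<bar>f x\<bar> \<le> C"
  shows "f \<in> L2 M"
proof -
  have "integrable M (\<lambda>x. (f x)\<^sup>2)"
    using assms(1) power_mono[OF assms(2) abs_ge_zero, of _ 2]
    by (intro integrable_bounded[of _ "C\<^sup>2"]) simp_all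
  then show ?thesis using assms by (simp add: L2_def)
qed

end

lemma torus_measure_dW:
  assumes "strict_mono W" "cadlag_on UNIV W"
  shows "torus_measure (dW W)"
proof (intro torus_measure.intro torus_measure_axioms.intro finite_measureI)
  have "emeasure (interval_measure W) {0..<1} \<le> emeasure (interval_measure W) {-1<..1}"
    by (intro emeasure_mono) auto
  also have "\<dots> = ennreal (W 1 - W (-1))"
    using assms by (intro emeasure_interval_measure_Ioc)
       (auto simp: cadlag_on_def continuous_within strict_mono_less_eq)
  finally have "emeasure (interval_measure W) {0..<1} \<noteq> \<infinity>"
    by (auto simp: top_unique)
  then show "emeasure (dW W) (space (dW W)) \<noteq> \<infinity>"
    by (simp add: dW_def space_restrict_space emeasure_restrict_space)
qed (auto simp: dW_def space_restrict_space sets_restrict_space)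

lemma torus_measure_dV:
  assumes "strict_mono V" "caglad_on UNIV V"
  shows "torus_measure (dV V)"
proof (intro torus_measure.intro torus_measure_axioms.intro finite_measureI)
  have "space (dV V) = {0..<1}" by (simp add: dV_def space_restrict_space)
  then show "emeasure (dV V) (space (dV V)) \<noteq> \<infinity>"
    using emeasure_dV[OF assms, of 0 1] by simp
qed (auto simp: dV_def space_restrict_space sets_restrict_space)

text \<open>
  This is where continuity of \<open>W\<close> at the tagged point enters: integrals over \<open>(0,x]\<close> and over
  \<open>[0,x]\<close> agree, so primitives see all of the measure.
\<close>

lemma dW_no_atom_0:
  assumes "strict_mono W" "cadlag_on UNIV W" "isCont W 0"
  shows "emeasure (dW W) {0} = 0"
proof -
  have le: "emeasure (interval_measure W) {0} \<le> ennreal (W 0 - W (- (1 / real (Suc n))))" for n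
  proof -
    have "emeasure (interval_measure W) {0} \<le> emeasure (interval_measure W) {- (1 / real (Suc n))<..0}"
      by (intro emeasure_mono) auto
    also have "\<dots> = ennreal (W 0 - W (- (1 / real (Suc n))))"
      using assms by (intro emeasure_interval_measure_Ioc)
         (auto simp: cadlag_on_def continuous_within strict_mono_less_eq)
    finally show ?thesis .
  qed
  have "(\<lambda>n. - (1 / real (Suc n))) \<longlonglongrightarrow> 0"
    using tendsto_minus[OF LIMSEQ_inverse_real_of_nat] by (simp add: inverse_eq_divide)
  then have "(\<lambda>n. W (- (1 / real (Suc n)))) \<longlonglongrightarrow> W 0"
    using assms(3) isCont_tendsto_compose by blast
  then have "(\<lambda>n. ennreal (W 0 - W (- (1 / real (Suc n))))) \<longlonglongrightarrow> ennreal (W 0 - W 0)"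
    by (intro tendsto_intros) auto
  then have "emeasure (interval_measure W) {0} \<le> 0"
    using le by (intro LIMSEQ_le_const[of _ _ "emeasure (interval_measure W) {0}"]) auto
  then show ?thesis
    by (simp add: dW_def emeasure_restrict_space)
qed

section \<open>Left limits of cadlag paths\<close>

text \<open>
  A function with one-sided limits is bounded near every point, and local boundedness on a compact
  interval is global boundedness; the latter is bisection.
\<close>

lemma cadlag_on_bounded:
  fixes b :: "real \<Rightarrow> real"
  assumes "cadlag_on {x..y} b" "x \<le> y"
  shows "\<exists>C. \<forall>t\<in>{x..y}. \<bar>b t\<bar> \<le> C"
proof -
  define P where "P p q \<longleftrightarrow> (\<exists>C. \<forall>t\<in>{p..q} \<inter> {x..y}. \<bar>b t\<bar> \<le> C)" for p q
  have "P x y"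
    using assms(2)
  proof (induction rule: Bolzano)
    case (trans p q r)
    then obtain C1 C2 where C: "\<forall>t\<in>{p..q} \<inter> {x..y}. \<bar>b t\<bar> \<le> C1" "\<forall>t\<in>{q..r} \<inter> {x..y}. \<bar>b t\<bar> \<le> C2"
      unfolding P_def by blast
    have "\<forall>t\<in>{p..r} \<inter> {x..y}. \<bar>b t\<bar> \<le> max C1 C2"
    proof
      fix t assume "t \<in> {p..r} \<inter> {x..y}"
      then show "\<bar>b t\<bar> \<le> max C1 C2" using C by (cases "t \<le> q") (auto simp: le_max_iff_disj)
    qed
    then show ?case unfolding P_def by blast
  next
    case (local t)
    then have t: "t \<in> {x..y}" by auto
    from assms(1) t obtain l where
        r: "(b \<longlongrightarrow> b t) (at t within {x..y} \<inter> {t<..})"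
      and l: "(b \<longlongrightarrow> l) (at t within {x..y} \<inter> {..<t})"
      unfolding cadlag_on_def by blast
    have *: "\<exists>d>0. \<forall>s\<in>S. s \<noteq> t \<and> dist s t < d \<longrightarrow> \<bar>b s\<bar> < \<bar>c\<bar> + 1"
      if lim: "(b \<longlongrightarrow> c) (at t within S)" for c S
    proof -
      have "eventually (\<lambda>s. dist (b s) c < 1) (at t within S)"
        using tendstoD[OF lim, of 1] by simp
      then have "eventually (\<lambda>s. \<bar>b s\<bar> < \<bar>c\<bar> + 1) (at t within S)"
        by eventually_elim (auto simp: dist_real_def)
      then show ?thesis by (simp add: eventually_at)
    qed
    obtain d1 where d1: "d1 > 0"
      "\<forall>s\<in>{x..y} \<inter> {t<..}. s \<noteq> t \<and> dist s t < d1 \<longrightarrow> \<bar>b s\<bar> < \<bar>b t\<bar> + 1"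
      using *[OF r] by blast
    obtain d2 where d2: "d2 > 0"
      "\<forall>s\<in>{x..y} \<inter> {..<t}. s \<noteq> t \<and> dist s t < d2 \<longrightarrow> \<bar>b s\<bar> < \<bar>l\<bar> + 1"
      using *[OF l] by blast
    show ?case
    proof (intro exI[of _ "min d1 d2"] conjI allI impI)
      show "0 < min d1 d2" using d1 d2 by simp
      fix p q assume pq: "p \<le> t \<and> t \<le> q \<and> q - p < min d1 d2"
      have "\<bar>b s\<bar> \<le> max (\<bar>b t\<bar> + 1) (\<bar>l\<bar> + 1)" if "s \<in> {p..q} \<inter> {x..y}" for s
      proof (cases s t rule: linorder_cases)
        case less
        then have "\<bar>b s\<bar> < \<bar>l\<bar> + 1" using d2 that pq by (auto simp: dist_real_def)
        then show ?thesis by simp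
      next
        case greater
        then have "\<bar>b s\<bar> < \<bar>b t\<bar> + 1" using d1 that pq by (auto simp: dist_real_def)
        then show ?thesis by simp
      qed simp
      then show "P p q" unfolding P_def by blast
    qed
  qed
  then show ?thesis unfolding P_def by auto
qed

lemma cadlag_left_limit:
  fixes b :: "real \<Rightarrow> real"
  assumes "cadlag_on {x..y} b" "x < s" "s \<le> y"
  shows "(b \<longlongrightarrow> Lim (at_left s) b) (at_left s)"
proof -
  obtain l where l: "(b \<longlongrightarrow> l) (at s within {x..y} \<inter> {..<s})"
    using assms unfolding cadlag_on_def by (metis atLeastAtMost_iff less_imp_le)
  have "at s within {x..y} \<inter> {..<s} = at_left s"
  proof (rule at_within_nhd)
    show "s \<in> {x<..}" "open {x<..}" using assms by auto
    show "{x..y} \<inter> {..<s} \<inter> {x<..} - {s} = {..<s} \<inter> {x<..} - {s}"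
      using assms by auto
  qed
  with l have "(b \<longlongrightarrow> l) (at_left s)" by simp
  moreover from this have "Lim (at_left s) b = l"
    by (intro tendsto_Lim) auto
  ultimately show ?thesis by simp
qed

text \<open>
  The left limit at \<open>s\<close> is the limit of \<open>b\<close> along the largest multiple of \<open>1/(n+1)\<close> strictly below
  \<open>s\<close>. Each approximation takes one value per grid cell, hence is measurable. At \<open>s = 0\<close> the path to
  the left lies outside \<open>[0,1]\<close> and \<open>Lim\<close> is an arbitrary number, so this point is treated apart.
\<close>

lemma (in torus_measure) left_limit_bounded_measurable:
  fixes b :: "real \<Rightarrow> real"
  assumes b: "cadlag_on {0..1} b"
  shows "(\<lambda>s. Lim (at_left s) b) \<in> borel_measurable M"
    and "\<exists>C. \<forall>s\<in>space M. \<bar>Lim (at_left s) b\<bar> \<le> C"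
proof -
  define p where "p n s = (real_of_int \<lceil>real (Suc n) * s\<rceil> - 1) / real (Suc n)" for n and s :: real
  have p_less: "p n s < s" and p_ge: "s - 1 / real (Suc n) \<le> p n s" for n s
  proof -
    have "real_of_int \<lceil>real (Suc n) * s\<rceil> - 1 < s * real (Suc n)"
      using ceiling_correct[of "real (Suc n) * s"] by (simp add: mult.commute)
    then show "p n s < s"
      unfolding p_def by (subst pos_divide_less_eq) auto
    have "s * real (Suc n) - 1 \<le> real_of_int \<lceil>real (Suc n) * s\<rceil> - 1"
      using ceiling_correct[of "real (Suc n) * s"] by (simp add: mult.commute)
    then have "(s * real (Suc n) - 1) / real (Suc n) \<le> p n s"
      unfolding p_def by (intro divide_right_mono) auto
    then show "s - 1 / real (Suc n) \<le> p n s" by (simp add: diff_divide_distrib)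
  qed
  have p_lim: "filterlim (\<lambda>n. p n s) (at_left s) sequentially" for s
    unfolding filterlim_at
  proof
    have "(\<lambda>n. s - 1 / real (Suc n)) \<longlonglongrightarrow> s"
      using tendsto_diff[OF tendsto_const LIMSEQ_inverse_real_of_nat, of s]
      by (simp add: inverse_eq_divide)
    then show "(\<lambda>n. p n s) \<longlonglongrightarrow> s"
      by (rule tendsto_sandwich[OF _ _ _ tendsto_const, rotated 2])
         (intro always_eventually allI p_ge less_imp_le[OF p_less])+
    show "\<forall>\<^sub>F n in sequentially. p n s \<in> {..<s} \<and> p n s \<noteq> s"
      using p_less[of _ s] by (intro always_eventually allI) (simp add: less_imp_neq)
  qed
  have lim: "(\<lambda>n. b (p n s)) \<longlonglongrightarrow> Lim (at_left s) b" if "0 < s" "s < 1" for s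
    using filterlim_compose[OF cadlag_left_limit[OF b, of s] p_lim] that by simp
  have "(\<lambda>s. if s = 0 then Lim (at_left 0) b else b (p n s)) \<in> borel_measurable M" for n
  proof -
    have "(\<lambda>s. \<lceil>real (Suc n) * s\<rceil>) \<in> borel \<rightarrow>\<^sub>M count_space UNIV" by measurable
    then have "(\<lambda>s. \<lceil>real (Suc n) * s\<rceil>) \<in> M \<rightarrow>\<^sub>M count_space UNIV"
      by (rule measurable_compose[OF ident_measurable])
    from measurable_compose[OF this borel_measurable_count_space,
        of "\<lambda>k. b ((real_of_int k - 1) / real (Suc n))"]
    have [measurable]: "(\<lambda>s. b (p n s)) \<in> borel_measurable M"
      unfolding p_def .
    show ?thesis by measurable
  qed
  then show "(\<lambda>s. Lim (at_left s) b) \<in> borel_measurable M"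
  proof (rule borel_measurable_LIMSEQ_real[rotated])
    fix s assume "s \<in> space M"
    then show "(\<lambda>n. if s = 0 then Lim (at_left 0) b else b (p n s)) \<longlonglongrightarrow> Lim (at_left s) b"
      using lim[of s] by (cases "s = 0") (auto simp: space_torus)
  qed
  obtain C where C: "\<forall>t\<in>{0..1}. \<bar>b t\<bar> \<le> C"
    using cadlag_on_bounded[OF b] by auto
  have "\<bar>Lim (at_left s) b\<bar> \<le> max C \<bar>Lim (at_left 0) b\<bar>" if "s \<in> space M" for s
  proof (cases "s = 0")
    case False
    then have s: "0 < s" "s < 1" using that by (auto simp: space_torus)
    have "eventually (\<lambda>t. t \<in> {0<..<s}) (at_left s)"
      using s by (auto simp: eventually_at_left_field)
    then have "eventually (\<lambda>t. \<bar>b t\<bar> \<le> C) (at_left s)"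
      by eventually_elim (use C s in auto)
    then have "\<bar>Lim (at_left s) b\<bar> \<le> C"
      by (intro tendsto_upperbound[OF tendsto_rabs[OF cadlag_left_limit[OF b]]]) (use s in auto)
    then show ?thesis by simp
  qed simp
  then show "\<exists>C. \<forall>s\<in>space M. \<bar>Lim (at_left s) b\<bar> \<le> C" by blast
qed

section \<open>An exponential weight for measures with atoms\<close>

lemma exp_increment_ge:
  fixes a b l :: real
  assumes "0 < l"
  shows "exp (l * a) * (b - a) \<le> (exp (l * b) - exp (l * a)) / l"
proof -
  have "exp (l * a) * (1 + l * (b - a)) \<le> exp (l * a) * exp (l * (b - a))"
    by (intro mult_left_mono exp_ge_add_one_self) auto
  also have "\<dots> = exp (l * b)"
    by (simp add: mult_exp_exp algebra_simps)
  finally have "exp (l * a) * (b - a) * l \<le> exp (l * b) - exp (l * a)"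
    by (simp add: algebra_simps)
  then show ?thesis using assms by (simp add: pos_le_divide_eq)
qed

text \<open>
  For continuous \<open>V\<close> this is the substitution \<open>t = V(y)\<close>. In general, approximate \<open>exp (l V)\<close> by
  step functions that take the value at the left end of each grid cell. Their integrals stay below the
  telescoping sum of \<open>exp_increment_ge\<close>, and they converge to the integrand at every \<open>y\<close>, atoms
  included, because \<open>V\<close> is left-continuous.
\<close>

lemma exp_weight_dV:
  assumes V: "strict_mono V" "caglad_on UNIV V" and l: "0 < l" and x: "0 \<le> x" "x < 1"
  shows "(LINT y|dV V. indicator {..<x} y * exp (l * V y)) \<le> exp (l * V x) / l"
proof (cases "x = 0")
  case True
  have "(LINT y|dV V. indicator {..<x} y * exp (l * V y)) = (LINT y|dV V. 0)"
    using True by (intro Bochner_Integration.integral_cong) (auto simp: dV_def space_restrict_space)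
  then show ?thesis using l by simp
next
  case False
  then have x0: "0 < x" using x by simp
  interpret torus_measure "dV V" using V by (rule torus_measure_dV)
  have V_meas [measurable]: "V \<in> borel_measurable borel"
    using V(1) by (intro borel_measurable_mono strict_mono_mono)
  have V_le: "s \<le> t \<Longrightarrow> V s \<le> V t" for s t
    using V(1) by (simp add: strict_mono_less_eq)
  define p where "p n k = real k * x / real (Suc n)" for n k
  define J where "J n k = {p n k..<p n (Suc k)}" for n k
  have p_mono: "p n k \<le> p n m" if "k \<le> m" for n k m
    unfolding p_def using x0 that by (intro divide_right_mono mult_right_mono) auto
  have p_bounds: "0 \<le> p n k" "k \<le> Suc n \<Longrightarrow> p n k \<le> x" for n k
  proof -
    show "0 \<le> p n k" unfolding p_def using x0 by simp
    assume "k \<le> Suc n"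
    then have "p n k \<le> p n (Suc n)" by (rule p_mono)
    then show "p n k \<le> x" by (simp add: p_def)
  qed
  define f where "f n y = (\<Sum>k\<le>n. exp (l * V (p n k)) * indicator (J n k) y)" for n y
  \<comment> \<open>the index of the grid cell that contains \<open>y\<close>\<close>
  define loc where "loc n y = nat \<lfloor>y * real (Suc n) / x\<rfloor>" for n y
  have loc: "y \<in> J n k \<longleftrightarrow> k = loc n y" if "0 \<le> y" for n k y
  proof -
    have "y \<in> J n k \<longleftrightarrow> real k \<le> y * real (Suc n) / x \<and> y * real (Suc n) / x < real k + 1"
      using x0 by (auto simp: J_def p_def field_simps)
    also have "\<dots> \<longleftrightarrow> \<lfloor>y * real (Suc n) / x\<rfloor> = int k"
      by (simp add: floor_eq_iff)
    also have "\<dots> \<longleftrightarrow> k = loc n y"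
      using that x0 by (auto simp: loc_def)
    finally show ?thesis .
  qed
  have loc_le: "loc n y \<le> n" if "0 \<le> y" "y < x" for n y
  proof (rule ccontr)
    assume "\<not> loc n y \<le> n"
    then have "p n (Suc n) \<le> p n (loc n y)" by (intro p_mono) simp
    also have "\<dots> \<le> y" using loc[OF that(1), of n "loc n y"] by (simp add: J_def)
    finally show False using that by (simp add: p_def)
  qed
  have f_eq: "f n y = (if y < x then exp (l * V (p n (loc n y))) else 0)" if y: "0 \<le> y" for n y
  proof (cases "y < x")
    case True
    have "f n y = (\<Sum>k\<le>n. if k = loc n y then exp (l * V (p n k)) else 0)"
      unfolding f_def using y by (intro sum.cong) (auto simp: loc indicator_def)
    also have "\<dots> = exp (l * V (p n (loc n y)))" using loc_le[OF y True] by simp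
    finally show ?thesis using True by simp
  next
    case False
    have "y \<notin> J n k" if "k \<le> n" for k
      using False p_bounds(2)[of "Suc k" n] that by (auto simp: J_def)
    then show ?thesis using False by (simp add: f_def)
  qed
  have int_f: "(LINT y|dV V. f n y) \<le> exp (l * V x) / l" for n
  proof -
    have J_meas: "J n k \<in> sets (dV V)" if "k \<le> n" for k
      unfolding sets_torus sets_restrict_space J_def
      using p_bounds[of n k] p_bounds(2)[of "Suc k" n] x that
      by (intro image_eqI[of _ _ "{p n k..<p n (Suc k)}"]) auto
    have m: "measure (dV V) (J n k) = V (p n (Suc k)) - V (p n k)" if "k \<le> n" for k
      unfolding measure_def J_def
      using p_bounds[of n k] p_bounds(2)[of "Suc k" n] x that p_mono[of k "Suc k" n]
      by (subst emeasure_dV[OF V]) (auto simp: V_le)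
    have "(LINT y|dV V. f n y) = (\<Sum>k\<le>n. exp (l * V (p n k)) * measure (dV V) (J n k))"
      unfolding f_def using J_meas
      by (subst Bochner_Integration.integral_sum)
         (auto intro!: sum.cong integrable_real_indicator emeasure_finite simp: less_top[symmetric])
    also have "\<dots> = (\<Sum>k\<le>n. exp (l * V (p n k)) * (V (p n (Suc k)) - V (p n k)))"
      by (intro sum.cong) (auto simp: m)
    also have "\<dots> \<le> (\<Sum>k\<le>n. (exp (l * V (p n (Suc k))) - exp (l * V (p n k))) / l)"
      using l by (intro sum_mono exp_increment_ge)
    also have "\<dots> = (exp (l * V (p n (Suc n))) - exp (l * V (p n 0))) / l"
      unfolding sum_divide_distrib[symmetric] lessThan_Suc_atMost[symmetric]
      by (subst sum_lessThan_telescope) (rule refl)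
    also have "\<dots> \<le> exp (l * V x) / l"
      using l by (simp add: p_def divide_right_mono)
    finally show ?thesis .
  qed
  have "(\<lambda>n. LINT y|dV V. f n y) \<longlonglongrightarrow> (LINT y|dV V. indicator {..<x} y * exp (l * V y))"
  proof (rule integral_dominated_convergence[where w = "\<lambda>_. exp (l * V x)"])
    show "(\<lambda>y. indicator {..<x} y * exp (l * V y)) \<in> borel_measurable (dV V)"
      by (rule borel_imp_measurable) simp
    show "f n \<in> borel_measurable (dV V)" for n
      unfolding f_def J_def by (rule borel_imp_measurable) measurable
    show "integrable (dV V) (\<lambda>_. exp (l * V x))" by simp
    show "AE y in dV V. (\<lambda>n. f n y) \<longlonglongrightarrow> indicator {..<x} y * exp (l * V y)"
    proof (rule AE_I2)
      fix y assume "y \<in> space (dV V)"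
      then have y: "0 \<le> y" by (simp add: space_torus)
      show "(\<lambda>n. f n y) \<longlonglongrightarrow> indicator {..<x} y * exp (l * V y)"
      proof (cases "y < x")
        case True
        let ?q = "\<lambda>n. p n (loc n y)"
        have q: "?q n \<le> y" "y - x / real (Suc n) \<le> ?q n" for n
        proof -
          have "y \<in> J n (loc n y)" using loc[OF y] by simp
          then have *: "?q n \<le> y" "y < p n (Suc (loc n y))" by (auto simp: J_def)
          have "p n (Suc (loc n y)) = ?q n + x / real (Suc n)"
            by (simp add: p_def add_divide_distrib algebra_simps)
          then show "?q n \<le> y" "y - x / real (Suc n) \<le> ?q n" using * by simp_all
        qed
        have "(\<lambda>n. y - x * inverse (real (Suc n))) \<longlonglongrightarrow> y - x * 0"
          by (intro tendsto_intros LIMSEQ_inverse_real_of_nat)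
        then have "(\<lambda>n. y - x / real (Suc n)) \<longlonglongrightarrow> y"
          by (simp only: divide_inverse mult_zero_right diff_0_right)
        then have q_lim: "?q \<longlonglongrightarrow> y"
          by (rule tendsto_sandwich[OF _ _ _ tendsto_const, rotated 2])
             (intro always_eventually allI q)+
        have "(V \<longlongrightarrow> V y) (at_left y)"
          using V(2) by (simp add: caglad_on_def)
        moreover have "at_left y = at y within {..y}"
          unfolding at_within_def by (rule arg_cong[of _ _ "\<lambda>S. inf (nhds y) (principal S)"]) auto
        ultimately have "continuous (at y within {..y}) V"
          by (simp add: continuous_within)
        then have "(\<lambda>n. V (?q n)) \<longlonglongrightarrow> V y"
          by (rule continuous_within_tendsto_compose') (use q(1) q_lim in auto)
        then have "(\<lambda>n. exp (l * V (?q n))) \<longlonglongrightarrow> exp (l * V y)"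
          by (intro tendsto_intros)
        then show ?thesis using True y by (simp add: f_eq)
      qed (simp add: f_eq[OF y])
    qed
    show "AE y in dV V. norm (f n y) \<le> exp (l * V x)" for n
    proof (rule AE_I2)
      fix y assume "y \<in> space (dV V)"
      then have y: "0 \<le> y" by (simp add: space_torus)
      show "norm (f n y) \<le> exp (l * V x)"
        using l p_bounds(2)[of "loc n y" n] loc_le[OF y, of n] by (auto simp: f_eq[OF y] V_le)
    qed
  qed
  then show ?thesis
    using int_f by (intro LIMSEQ_le_const2) auto
qed

section \<open>Volterra equations by Neumann series\<close>

text \<open>
  The iterates on \<open>f\<close> of the integral operator with kernel \<open>K\<close> decay like \<open>q\<^sup>n \<phi>\<close>, so their sum converges to a bounded function. Each iterate of a nonnegative \<open>f\<close> is nonnegative; hence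
  positivity passes to the sum. The equation is asked for at every point, not almost everywhere,
  since the solution has to be the cadlag representative.
\<close>

lemma (in finite_measure) Neumann_series:
  fixes K :: "'a \<Rightarrow> 'a \<Rightarrow> real" and f \<phi> :: "'a \<Rightarrow> real"
  assumes K [measurable]: "case_prod K \<in> borel_measurable (M \<Otimes>\<^sub>M M)"
    and f [measurable]: "f \<in> borel_measurable M"
    and \<phi> [measurable]: "\<phi> \<in> borel_measurable M"
    and K_bounds: "\<And>x y. x \<in> space M \<Longrightarrow> y \<in> space M \<Longrightarrow> 0 \<le> K x y \<and> K x y \<le> C"
    and \<phi>_bounds: "\<And>x. x \<in> space M \<Longrightarrow> 0 \<le> \<phi> x \<and> \<phi> x \<le> \<Phi>"
    and f_bound: "\<And>x. x \<in> space M \<Longrightarrow> \<bar>f x\<bar> \<le> c * \<phi> x"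
    and c: "0 \<le> c" and q: "0 \<le> q" "q < 1"
    and contr: "\<And>x. x \<in> space M \<Longrightarrow> (\<integral>y. K x y * \<phi> y \<partial>M) \<le> q * \<phi> x"
  obtains u D where "u \<in> borel_measurable M" "\<And>x. x \<in> space M \<Longrightarrow> \<bar>u x\<bar> \<le> D"
    "\<And>x. x \<in> space M \<Longrightarrow> u x = f x + (\<integral>y. K x y * u y \<partial>M)"
    "(\<forall>x\<in>space M. 0 \<le> f x) \<longrightarrow> (\<forall>x\<in>space M. 0 \<le> u x)"
proof -
  define T where "T h x = (\<integral>y. K x y * h y \<partial>M)" for h x
  define a where "a n = (T ^^ n) f" for n
  have a_Suc: "a (Suc n) x = (\<integral>y. K x y * a n y \<partial>M)" for n x
    by (simp add: a_def T_def)
  have a_meas [measurable]: "a n \<in> borel_measurable M" for n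
  proof (induction n)
    case (Suc n)
    have "(\<lambda>x. \<integral>y. K x y * a n y \<partial>M) \<in> borel_measurable M"
      using Suc by measurable
    then show ?case by (simp add: a_Suc[abs_def])
  qed (simp add: a_def)
  have Kx [measurable]: "K x \<in> borel_measurable M" if "x \<in> space M" for x
    using measurable_compose[OF measurable_Pair1'[OF that] K] by simp
  have K_int: "integrable M (\<lambda>y. K x y * h y)"
    if "x \<in> space M" "h \<in> borel_measurable M" "\<And>y. y \<in> space M \<Longrightarrow> \<bar>h y\<bar> \<le> D" for x h D
  proof (rule integrable_const_bound[of _ "C * D"])
    note [measurable] = that(2) Kx[OF that(1)]
    show "(\<lambda>y. K x y * h y) \<in> borel_measurable M" by measurable
    show "AE y in M. norm (K x y * h y) \<le> C * D"
    proof (rule AE_I2)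
      fix y assume y: "y \<in> space M"
      have "K x y * \<bar>h y\<bar> \<le> C * D"
        using K_bounds[OF that(1) y] that(3)[OF y] by (intro mult_mono) auto
      then show "norm (K x y * h y) \<le> C * D"
        using K_bounds[OF that(1) y] by (simp add: abs_mult)
    qed
  qed
  have \<Phi>: "\<phi> x \<le> \<Phi>" "0 \<le> \<phi> x" if "x \<in> space M" for x using \<phi>_bounds[OF that] by auto
  have absint: "(\<integral>y. K x y * \<bar>h y\<bar> \<partial>M) \<le> D * (q * \<phi> x)"
    if x: "x \<in> space M" and h: "h \<in> borel_measurable M" "\<And>y. y \<in> space M \<Longrightarrow> \<bar>h y\<bar> \<le> D * \<phi> y"
      and D: "0 \<le> D" for x h D
  proof -
    have "(\<integral>y. K x y * \<bar>h y\<bar> \<partial>M) \<le> (\<integral>y. D * (K x y * \<phi> y) \<partial>M)"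
    proof (rule integral_mono)
      have "\<bar>h y\<bar> \<le> D * \<Phi>" if "y \<in> space M" for y
        using h(2)[OF that] mult_left_mono[OF \<Phi>(1)[OF that] D] by linarith
      then show "integrable M (\<lambda>y. K x y * \<bar>h y\<bar>)"
        using h(1) x by (intro K_int[of _ _ "D * \<Phi>"]) auto
      show "integrable M (\<lambda>y. D * (K x y * \<phi> y))"
        using x \<Phi> by (intro integrable_mult_right K_int[of _ _ \<Phi>]) auto
      fix y assume y: "y \<in> space M"
      show "K x y * \<bar>h y\<bar> \<le> D * (K x y * \<phi> y)"
        using mult_left_mono[OF h(2)[OF y], of "K x y"] K_bounds[OF x y] by (simp add: mult_ac)
    qed
    also have "\<dots> \<le> D * (q * \<phi> x)"
      using mult_left_mono[OF contr[OF x] D] by simp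
    finally show ?thesis .
  qed
  have a_bound: "\<bar>a n x\<bar> \<le> c * q ^ n * \<phi> x" if "x \<in> space M" for n x
    using that
  proof (induction n arbitrary: x)
    case (Suc n)
    have "\<bar>a (Suc n) x\<bar> \<le> (\<integral>y. K x y * \<bar>a n y\<bar> \<partial>M)"
    proof -
      have "\<bar>a (Suc n) x\<bar> \<le> (\<integral>y. \<bar>K x y * a n y\<bar> \<partial>M)"
        unfolding a_Suc by (rule integral_abs_bound)
      also have "\<dots> = (\<integral>y. K x y * \<bar>a n y\<bar> \<partial>M)"
        using K_bounds[OF Suc.prems] by (intro Bochner_Integration.integral_cong) (auto simp: abs_mult)
      finally show ?thesis .
    qed
    also have "\<dots> \<le> c * q ^ n * (q * \<phi> x)"
      using Suc c q by (intro absint) auto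
    finally show ?case by (simp add: mult_ac)
  qed (simp add: a_def f_bound)
  have geo: "summable (\<lambda>n. c * q ^ n * d)" for d
    using q by (intro summable_mult2 summable_mult summable_geometric) auto
  have a_summable_norm: "summable (\<lambda>n. \<bar>a n x\<bar>)" if "x \<in> space M" for x
    by (rule summable_comparison_test'[OF geo[of "\<phi> x"], of 0]) (use a_bound[OF that] in auto)
  have a_summable: "summable (\<lambda>n. a n x)" if "x \<in> space M" for x
    by (rule summable_rabs_cancel[OF a_summable_norm[OF that]])
  define u where "u x = (\<Sum>n. a n x)" for x
  have u_meas: "u \<in> borel_measurable M"
    unfolding u_def[abs_def] by measurable
  have u_bound: "\<bar>u x\<bar> \<le> (\<Sum>n. c * q ^ n * \<Phi>)" if "x \<in> space M" for x
  proof -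
    have "\<bar>u x\<bar> \<le> (\<Sum>n. \<bar>a n x\<bar>)"
      unfolding u_def by (rule summable_rabs[OF a_summable_norm[OF that]])
    also have "\<dots> \<le> (\<Sum>n. c * q ^ n * \<Phi>)"
    proof (rule suminf_le[OF _ a_summable_norm[OF that] geo])
      fix n
      have "c * q ^ n * \<phi> x \<le> c * q ^ n * \<Phi>"
        using \<Phi>[OF that] c q by (intro mult_left_mono) auto
      then show "\<bar>a n x\<bar> \<le> c * q ^ n * \<Phi>" using a_bound[OF that, of n] by linarith
    qed
    finally show ?thesis .
  qed
  have u_eq: "u x = f x + (\<integral>y. K x y * u y \<partial>M)" if x: "x \<in> space M" for x
  proof -
    have a_int: "integrable M (\<lambda>y. K x y * a n y)" for n
    proof (rule K_int[OF x a_meas])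
      fix y assume y: "y \<in> space M"
      have "c * q ^ n * \<phi> y \<le> c * q ^ n * \<Phi>"
        using \<Phi>[OF y] c q by (intro mult_left_mono) auto
      then show "\<bar>a n y\<bar> \<le> c * q ^ n * \<Phi>" using a_bound[OF y, of n] by linarith
    qed
    have "(\<integral>y. K x y * u y \<partial>M) = (\<integral>y. (\<Sum>n. K x y * a n y) \<partial>M)"
      using a_summable
      by (intro Bochner_Integration.integral_cong refl) (simp add: u_def suminf_mult[symmetric])
    also have "\<dots> = (\<Sum>n. \<integral>y. K x y * a n y \<partial>M)"
    proof (rule integral_suminf[OF a_int])
      show "AE y in M. summable (\<lambda>n. norm (K x y * a n y))"
        using a_summable_norm by (intro AE_I2) (simp add: abs_mult summable_mult)
      have eq: "(\<integral>y. norm (K x y * a n y) \<partial>M) = (\<integral>y. K x y * \<bar>a n y\<bar> \<partial>M)" for n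
        using K_bounds[OF x] by (intro Bochner_Integration.integral_cong) (auto simp: abs_mult)
      show "summable (\<lambda>n. \<integral>y. norm (K x y * a n y) \<partial>M)"
        unfolding eq
      proof (rule summable_comparison_test'[OF geo[of "q * \<phi> x"], of 0])
        fix n
        have "0 \<le> (\<integral>y. K x y * \<bar>a n y\<bar> \<partial>M)"
          using K_bounds[OF x] by (intro integral_nonneg_AE AE_I2) auto
        then show "norm (\<integral>y. K x y * \<bar>a n y\<bar> \<partial>M) \<le> c * q ^ n * (q * \<phi> x)"
          using absint[OF x a_meas a_bound, of n] c q by simp
      qed
    qed
    also have "\<dots> = (\<Sum>n. a (Suc n) x)" by (simp add: a_Suc)
    finally show ?thesis
      using suminf_split_head[OF a_summable[OF x]] by (simp add: u_def a_def)
  qed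
  have u_nonneg: "0 \<le> u x" if f0: "\<And>x. x \<in> space M \<Longrightarrow> 0 \<le> f x" and x: "x \<in> space M" for x
  proof -
    have "0 \<le> a n x" if "x \<in> space M" for n x
      using that
    proof (induction n arbitrary: x)
      case (Suc n)
      then show ?case
        unfolding a_Suc using K_bounds[OF Suc.prems] by (intro integral_nonneg_AE AE_I2) auto
    qed (simp add: a_def f0)
    then show ?thesis unfolding u_def using a_summable x by (intro suminf_nonneg) auto
  qed
  show ?thesis
    by (rule that[OF u_meas u_bound u_eq]) (use u_nonneg in blast)+
qed

section \<open>Primitives\<close>

lemma borel_measurable_indicator_Ioc [measurable (raw)]:
  fixes a b f :: "'a \<Rightarrow> real"
  assumes [measurable]: "a \<in> borel_measurable M" "b \<in> borel_measurable M" "f \<in> borel_measurable M"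
  shows "(\<lambda>x. indicator {a x<..b x} (f x) :: real) \<in> borel_measurable M"
proof -
  have "(\<lambda>x. if a x < f x \<and> f x \<le> b x then 1 else 0 :: real) \<in> borel_measurable M"
    by measurable
  then show ?thesis by (simp add: indicator_def of_bool_def)
qed

lemma borel_measurable_indicator_lessThan [measurable (raw)]:
  fixes a f :: "'a \<Rightarrow> real"
  assumes [measurable]: "a \<in> borel_measurable M" "f \<in> borel_measurable M"
  shows "(\<lambda>x. indicator {..<a x} (f x) :: real) \<in> borel_measurable M"
proof -
  have "(\<lambda>x. if f x < a x then 1 else 0 :: real) \<in> borel_measurable M"
    by measurable
  then show ?thesis by (simp add: indicator_def of_bool_def)
qed

context torus_measure
begin

lemma AE_pos:
  assumes "emeasure M {0} = 0"
  shows "AE s in M. 0 < s"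
proof -
  have "{0} \<in> sets M"
    unfolding sets_torus sets_restrict_space by (intro image_eqI[of _ _ "{0}"]) auto
  then have "{0} \<in> null_sets M"
    using assms by (simp add: null_sets_def)
  then show ?thesis
    by (rule AE_I') (auto simp: space_torus)
qed

text \<open>
  The sets on which the integrals of \<open>f\<close> and \<open>g\<close> agree form a Dynkin system. It contains the
  half-lines, because \<open>(0,x]\<close> and \<open>[0,x]\<close> differ by a null set. This makes the \<open>W\<close>-derivative unique almost everywhere,
  so that the arbitrary representative chosen by \<open>DW\<close> can be replaced by an explicit one.
\<close>

lemma AE_eq_if_primitives_eq:
  assumes atom: "emeasure M {0} = 0"
    and f: "integrable M f" and g: "integrable M g"
    and total: "(LINT s|M. f s) = (LINT s|M. g s)"
    and prim: "\<And>x. 0 \<le> x \<Longrightarrow> x < 1 \<Longrightarrow>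
      (LINT s:{0<..x}|M. f s) = (LINT s:{0<..x}|M. g s)"
  shows "AE s in M. f s = (g s :: real)"
proof (rule density_unique_real[OF f g])
  have ind [measurable]: "indicator B \<in> borel_measurable M" if "B \<in> sets borel" for B :: "real set"
    using that by (intro borel_imp_measurable) simp
  have int: "integrable M (\<lambda>s. indicator B s * h s)"
    if "B \<in> sets borel" "integrable M h" for B :: "real set" and h :: "real \<Rightarrow> real"
    using that by (intro Bochner_Integration.integrable_bound[OF that(2)])
      (auto simp: indicator_def)
  have "(LINT s|M. indicator B s * (f s - g s)) = 0" if "B \<in> sets borel" for B
  proof -
    have B: "B \<in> sigma_sets UNIV (range (\<lambda>a::real. {..a}))"
      using that unfolding borel_eq_atMost by simp
    have borel: "C \<in> sets borel" if "C \<in> sigma_sets UNIV (range (\<lambda>a::real. {..a}))" for C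
      using that unfolding borel_eq_atMost by simp
    have stable: "Int_stable (range (\<lambda>a::real. {..a}))"
    proof (rule Int_stableI)
      fix A B assume "A \<in> range (\<lambda>a::real. {..a})" "B \<in> range (\<lambda>a::real. {..a})"
      then obtain a b where "A = {..a}" "B = {..b}" by auto
      then have "A \<inter> B = {..min a b}" by auto
      then show "A \<inter> B \<in> range (\<lambda>a::real. {..a})" by blast
    qed
    have "range (\<lambda>a::real. {..a}) \<subseteq> Pow UNIV" by simp
    from stable this B show ?thesis
    proof (induction B rule: sigma_sets_induct_disjoint)
      case (basic A)
      then obtain x where A: "A = {..x}" by auto
      consider "x < 0" | "0 \<le> x" "x < 1" | "1 \<le> x" by linarith
      then show ?case
      proof cases
        case 1
        then have "(LINT s|M. indicator A s * (f s - g s)) = (LINT s|M. 0)"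
          by (intro Bochner_Integration.integral_cong) (auto simp: A space_torus)
        then show ?thesis by simp
      next
        case 2
        have "(LINT s|M. indicator A s * (f s - g s)) =
            (LINT s|M. indicator {0<..x} s * f s - indicator {0<..x} s * g s)"
          using f g AE_pos[OF atom]
          by (intro integral_cong_AE)
             (auto simp: A indicator_def elim!: eventually_mono)
        also have "\<dots> = 0"
          using prim[OF 2] int[OF _ f] int[OF _ g]
          by (simp add: set_lebesgue_integral_def)
        finally show ?thesis .
      next
        case 3
        then have "(LINT s|M. indicator A s * (f s - g s)) = (LINT s|M. f s - g s)"
          by (intro Bochner_Integration.integral_cong) (auto simp: A space_torus)
        then show ?thesis using total f g by simp
      qed
    next
      case empty
      show ?case by simp
    next
      case (compl A)
      have "(LINT s|M. indicator (UNIV - A) s * (f s - g s)) =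
          (LINT s|M. (f s - g s) - indicator A s * (f s - g s))"
        by (intro Bochner_Integration.integral_cong) (auto simp: indicator_def)
      then show ?case
        using compl total f g int[OF borel[OF compl(1)], of "\<lambda>s. f s - g s"] by simp
    next
      case (union A)
      have "(\<lambda>n. LINT s|M. indicator (\<Union>i<n. A i) s * (f s - g s)) \<longlonglongrightarrow>
          (LINT s|M. indicator (\<Union>i. A i) s * (f s - g s))"
      proof (rule integral_dominated_convergence[where w = "\<lambda>s. \<bar>f s - g s\<bar>"])
        have A: "A i \<in> sets borel" for i using union(2) by (intro borel) auto
        show "(\<lambda>s. indicator (\<Union>i. A i) s * (f s - g s)) \<in> borel_measurable M"
          "(\<lambda>s. indicator (\<Union>i<n. A i) s * (f s - g s)) \<in> borel_measurable M" for n
          using f g A by (auto intro!: borel_measurable_times ind borel_measurable_diff)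
        show "AE s in M. (\<lambda>n. indicator (\<Union>i<n. A i) s * (f s - g s)) \<longlonglongrightarrow>
            indicator (\<Union>i. A i) s * (f s - g s)"
          by (intro AE_I2 tendsto_mult LIMSEQ_indicator_UN tendsto_const)
      qed (use f g in \<open>auto simp: indicator_def\<close>)
      moreover have "(LINT s|M. indicator (\<Union>i<n. A i) s * (f s - g s)) = 0" for n
      proof -
        have A: "A i \<in> sets borel" for i using union(2) by (intro borel) auto
        have "(LINT s|M. indicator (\<Union>i<n. A i) s * (f s - g s)) =
            (LINT s|M. (\<Sum>i<n. indicator (A i) s * (f s - g s)))"
          using union(1)
          by (intro Bochner_Integration.integral_cong refl)
             (simp add: indicator_UN_disjoint disjoint_family_on_mono[of "{..<n}" UNIV] sum_distrib_right)
        also have "\<dots> = (\<Sum>i<n. LINT s|M. indicator (A i) s * (f s - g s))"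
          using f g by (intro Bochner_Integration.integral_sum int A) auto
        finally show ?thesis using union(3) by simp
      qed
      ultimately show ?case by (simp add: LIMSEQ_const_iff)
    qed
  qed
  note zero = this
  fix A assume "A \<in> sets M"
  then obtain B where B: "B \<in> sets borel" "A = {0..<1} \<inter> B"
    unfolding sets_torus sets_restrict_space by auto
  have "(LINT s:A|M. h s) = (LINT s|M. indicator B s * h s)" for h :: "real \<Rightarrow> real"
    unfolding set_lebesgue_integral_def
    by (intro Bochner_Integration.integral_cong) (auto simp: B(2) space_torus indicator_def)
  then show "(LINT s:A|M. f s) = (LINT s:A|M. g s)"
    using zero[OF B(1)] int[OF B(1) f] int[OF B(1) g] by (simp add: right_diff_distrib)
qed

text \<open>
  As \<open>X\<^sub>i\<close> approaches \<open>t\<close>, the indicators of \<open>(0,X\<^sub>i]\<close> converge at every point, to that of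
  \<open>(0,t]\<close> from the right and to that of \<open>(0,t)\<close> from the left.
\<close>

lemma primitive_right_left_limits:
  fixes f :: "real \<Rightarrow> real"
  assumes f [measurable]: "integrable M f" and X: "X \<longlonglongrightarrow> t"
  shows "(\<And>i. t < X i) \<Longrightarrow>
      (\<lambda>i. LINT s:{0<..X i}|M. f s) \<longlonglongrightarrow> (LINT s:{0<..t}|M. f s)"
    and "(\<And>i. X i < t) \<Longrightarrow>
      (\<lambda>i. LINT s:{0<..X i}|M. f s) \<longlonglongrightarrow> (LINT s:{0<..<t}|M. f s)"
proof -
  have *: "(\<lambda>i. LINT s:{0<..X i}|M. f s) \<longlonglongrightarrow> (LINT s:A|M. f s)"
    if A: "A = {0<..t} \<or> A = {0<..<t}"
      and ev: "\<And>s. eventually (\<lambda>i. s \<in> {0<..X i} \<longleftrightarrow> s \<in> A) sequentially" for A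
    unfolding set_lebesgue_integral_def
  proof (rule integral_dominated_convergence[where w = "\<lambda>s. \<bar>f s\<bar>"])
    show "(\<lambda>s. indicator A s *\<^sub>R f s) \<in> borel_measurable M"
      using A by auto
    show "AE s in M. (\<lambda>i. indicator {0<..X i} s *\<^sub>R f s) \<longlonglongrightarrow> indicator A s *\<^sub>R f s"
    proof (rule AE_I2)
      fix s
      have "eventually (\<lambda>i. indicator {0<..X i} s *\<^sub>R f s = indicator A s *\<^sub>R f s) sequentially"
        using ev[of s] by eventually_elim (simp add: indicator_def)
      then show "(\<lambda>i. indicator {0<..X i} s *\<^sub>R f s) \<longlonglongrightarrow> indicator A s *\<^sub>R f s"
        by (rule tendsto_eventually)
    qed
  qed (use f in \<open>auto simp: indicator_def\<close>)
  show "(\<lambda>i. LINT s:{0<..X i}|M. f s) \<longlonglongrightarrow> (LINT s:{0<..t}|M. f s)" if "\<And>i. t < X i"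
  proof (rule *)
    fix s
    show "eventually (\<lambda>i. s \<in> {0<..X i} \<longleftrightarrow> s \<in> {0<..t}) sequentially"
    proof (cases "s \<le> t")
      case True
      then have "s \<le> X i" for i using that[of i] by simp
      then show ?thesis using True by simp
    next
      case False
      then have "eventually (\<lambda>i. X i < s) sequentially"
        using order_tendstoD(2)[OF X] by simp
      then show ?thesis by eventually_elim (use False in auto)
    qed
  qed simp
  show "(\<lambda>i. LINT s:{0<..X i}|M. f s) \<longlonglongrightarrow> (LINT s:{0<..<t}|M. f s)" if "\<And>i. X i < t"
  proof (rule *)
    fix s
    show "eventually (\<lambda>i. s \<in> {0<..X i} \<longleftrightarrow> s \<in> {0<..<t}) sequentially"
    proof (cases "s < t")
      case True
      then have "eventually (\<lambda>i. s < X i) sequentially"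
        using order_tendstoD(1)[OF X] by simp
      then show ?thesis by eventually_elim (use True in auto)
    next
      case False
      then have "\<not> s \<le> X i" for i using that[of i] by simp
      then show ?thesis using False by simp
    qed
  qed simp
qed

text \<open>
  Inside a period this is \<open>primitive_right_left_limits\<close>. At an integer the left limit is the value of
  the primitive over the whole preceding period, and the right limit starts afresh from \<open>c\<close>.
\<close>

lemma periodic_primitive_cadlag:
  fixes u f :: "real \<Rightarrow> real"
  assumes f: "integrable M f" and per: "periodic_fun_simple' u"
    and u: "\<And>x. 0 \<le> x \<Longrightarrow> x < 1 \<Longrightarrow> u x = c + (LINT s:{0<..x}|M. f s)"
  shows "cadlag_on UNIV u"
  unfolding cadlag_on_def
proof (intro ballI conjI)
  interpret u: periodic_fun_simple' u by (rule per)
  have shift: "u x = c + (LINT s:{0<..x - of_int n}|M. f s)"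
    if "of_int n \<le> x" "x < of_int n + 1" for n x
    using u[of "x - of_int n"] u.minus_of_int[of x n] that by simp
  fix t :: real
  show "(u \<longlongrightarrow> u t) (at t within UNIV \<inter> {t<..})"
    unfolding tendsto_at_iff_sequentially
  proof (intro allI impI)
    fix X assume "\<forall>i. X i \<in> UNIV \<inter> {t<..} - {t}" and X: "X \<longlonglongrightarrow> t"
    then have gt: "t < X i" for i by auto
    define n where "n = \<lfloor>t\<rfloor>"
    have n: "of_int n \<le> t" "t < of_int n + 1" unfolding n_def by linarith+
    have "(\<lambda>i. c + (LINT s:{0<..X i - of_int n}|M. f s)) \<longlonglongrightarrow> c + (LINT s:{0<..t - of_int n}|M. f s)"
      using gt by (intro tendsto_add tendsto_const primitive_right_left_limits(1) f tendsto_diff X) simp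
    moreover have "eventually (\<lambda>i. c + (LINT s:{0<..X i - of_int n}|M. f s) = (u \<circ> X) i) sequentially"
      using order_tendstoD(2)[OF X n(2)]
    proof eventually_elim
      case (elim i)
      show ?case using shift[of n "X i"] elim gt[of i] n(1) by simp
    qed
    ultimately show "(u \<circ> X) \<longlonglongrightarrow> u t"
      using shift[OF n] by (simp add: Lim_transform_eventually)
  qed
  show "\<exists>l. (u \<longlongrightarrow> l) (at t within UNIV \<inter> {..<t})"
  proof
    \<comment> \<open>at an integer \<open>t\<close>, the points to the left of \<open>t\<close> lie in the previous period\<close>
    define n where "n = \<lceil>t\<rceil> - 1"
    have n: "of_int n < t" "t \<le> of_int n + 1" unfolding n_def by linarith+
    show "(u \<longlongrightarrow> c + (LINT s:{0<..<t - of_int n}|M. f s)) (at t within UNIV \<inter> {..<t})"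
      unfolding tendsto_at_iff_sequentially
    proof (intro allI impI)
      fix X assume "\<forall>i. X i \<in> UNIV \<inter> {..<t} - {t}" and X: "X \<longlonglongrightarrow> t"
      then have lt: "X i < t" for i by auto
      have "(\<lambda>i. c + (LINT s:{0<..X i - of_int n}|M. f s)) \<longlonglongrightarrow> c + (LINT s:{0<..<t - of_int n}|M. f s)"
        using lt by (intro tendsto_add tendsto_const primitive_right_left_limits(2) f tendsto_diff X) simp
      moreover have "eventually (\<lambda>i. c + (LINT s:{0<..X i - of_int n}|M. f s) = (u \<circ> X) i) sequentially"
        using order_tendstoD(1)[OF X n(1)]
      proof eventually_elim
        case (elim i)
        show ?case using shift[of n "X i"] elim lt[of i] n(2) by simp
      qed
      ultimately show "(u \<circ> X) \<longlonglongrightarrow> c + (LINT s:{0<..<t - of_int n}|M. f s)"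
        by (rule Lim_transform_eventually)
    qed
  qed
qed

end

section \<open>The Volterra system\<close>

locale torus_measure_pair = M: torus_measure M + N: torus_measure N for M N
begin

sublocale pair_sigma_finite M N ..

sublocale P: finite_measure "M \<Otimes>\<^sub>M N"
  by (intro finite_measure_pair_measure M.finite_measure_axioms N.finite_measure_axioms)

lemma fst_measurable [measurable]: "(\<lambda>z. fst z) \<in> borel_measurable (M \<Otimes>\<^sub>M N)"
  using measurable_compose[OF measurable_fst M.ident_measurable] by simp

lemma snd_measurable [measurable]: "(\<lambda>z. snd z) \<in> borel_measurable (M \<Otimes>\<^sub>M N)"
  using measurable_compose[OF measurable_snd N.ident_measurable] by simp

text \<open>
  Integration by parts: by Fubini, \<open>G(s)\<close> is multiplied by the integral of \<open>p\<close> over \<open>x \<ge> s\<close>,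
  which is written as the total integral minus the one over \<open>[0,s)\<close>. The condition \<open>0 < s\<close> that the
  domain of the primitive contributes holds almost everywhere.
\<close>

lemma integral_mult_primitive:
  fixes p G :: "real \<Rightarrow> real"
  assumes atom: "emeasure N {0} = 0"
    and p [measurable]: "p \<in> borel_measurable M" and p_bound: "\<And>x. x \<in> space M \<Longrightarrow> \<bar>p x\<bar> \<le> C"
    and G: "integrable N G"
  shows "(LINT x|M. p x * (LINT s:{0<..x}|N. G s)) =
    (LINT s|N. ((LINT x|M. p x) - (LINT x:{..<s}|M. p x)) * G s)"
proof -
  have G_meas [measurable]: "G \<in> borel_measurable N" using G by simp
  define h where "h x s = p x * indicator {0<..x} s * G s" for x s
  have h_meas: "case_prod h \<in> borel_measurable (M \<Otimes>\<^sub>M N)"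
    unfolding h_def case_prod_beta' by measurable
  have h_le: "norm (h x s) \<le> C * norm (G s)" if "x \<in> space M" for x s
    using mult_right_mono[OF p_bound[OF that], of "\<bar>G s\<bar>"] p_bound[OF that]
    by (auto simp: h_def abs_mult indicator_def intro: order_trans[OF abs_ge_zero])
  have h_int_x: "integrable N (h x)" if x: "x \<in> space M" for x
  proof (rule Bochner_Integration.integrable_bound)
    show "integrable N (\<lambda>s. C * norm (G s))" using G by simp
    show "h x \<in> borel_measurable N" unfolding h_def by measurable
    show "AE s in N. norm (h x s) \<le> norm (C * norm (G s))"
      using h_le[OF x] by (intro AE_I2) (force intro: order_trans[OF _ abs_ge_self])
  qed
  have "integrable (M \<Otimes>\<^sub>M N) (case_prod h)"
  proof (rule Fubini_integrable[OF h_meas])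
    show "AE x in M. integrable N (\<lambda>s. case_prod h (x, s))"
      using h_int_x by (intro AE_I2) simp
    show "integrable M (\<lambda>x. \<integral>s. norm (case_prod h (x, s)) \<partial>N)"
    proof (rule M.integrable_bounded[of _ "LINT s|N. C * norm (G s)"])
      show "(\<lambda>x. \<integral>s. norm (case_prod h (x, s)) \<partial>N) \<in> borel_measurable M"
        using h_meas by measurable
      fix x assume x: "x \<in> space M"
      have "(\<integral>s. norm (h x s) \<partial>N) \<le> (\<integral>s. C * norm (G s) \<partial>N)"
        using h_int_x[OF x] G h_le[OF x] by (intro integral_mono) auto
      then show "\<bar>\<integral>s. norm (case_prod h (x, s)) \<partial>N\<bar> \<le> (\<integral>s. C * norm (G s) \<partial>N)"
        by (subst abs_of_nonneg) (auto intro: integral_nonneg_AE)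
    qed
  qed
  from Fubini_integral[OF this]
  have "(LINT x|M. LINT s|N. h x s) = (LINT s|N. LINT x|M. h x s)" by simp
  also have "(LINT x|M. LINT s|N. h x s) = (LINT x|M. p x * (LINT s:{0<..x}|N. G s))"
    by (simp add: h_def set_lebesgue_integral_def mult.assoc)
  also have "(LINT s|N. LINT x|M. h x s) =
      (LINT s|N. ((LINT x|M. p x) - (LINT x:{..<s}|M. p x)) * G s)"
  proof (rule integral_cong_AE)
    show "(\<lambda>s. LINT x|M. h x s) \<in> borel_measurable N"
      by (rule M.borel_measurable_lebesgue_integral)
         (use measurable_pair_swap[OF h_meas] in \<open>simp add: case_prod_beta'\<close>)
    show "(\<lambda>s. ((LINT x|M. p x) - (LINT x:{..<s}|M. p x)) * G s) \<in> borel_measurable N"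
      unfolding set_lebesgue_integral_def by measurable
    show "AE s in N. (LINT x|M. h x s) = ((LINT x|M. p x) - (LINT x:{..<s}|M. p x)) * G s"
      using N.AE_pos[OF atom]
    proof eventually_elim
      case (elim s)
      have p_int: "integrable M p" by (rule M.integrable_bounded[OF p p_bound])
      have pi_int: "integrable M (\<lambda>x. indicator {..<s} x * p x)"
        by (rule Bochner_Integration.integrable_bound[OF p_int]) (auto simp: indicator_def)
      have "(LINT x|M. h x s) = (LINT x|M. (p x - indicator {..<s} x * p x) * G s)"
        using elim by (intro Bochner_Integration.integral_cong) (auto simp: h_def indicator_def)
      then show ?case
        using p_int pi_int by (simp add: set_lebesgue_integral_def)
    qed
  qed
  finally show ?thesis .
qed

text \<open>
  Exchanging the order of integration turns the system into a single Volterra equation for \<open>u\<close> on \<open>M\<close>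
  with kernel \<open>K(x,y) = k(y) \<integral>\<^bsub>(y,x]\<^esub> r dN\<close>, which vanishes unless \<open>y < x\<close>. The weights of the
  last hypothesis make it contractive.
\<close>

lemma Volterra_system:
  fixes k r \<gamma> :: "real \<Rightarrow> real"
  assumes k [measurable]: "k \<in> borel_measurable M"
    and k_bounds: "\<And>x. x \<in> space M \<Longrightarrow> 0 \<le> k x \<and> k x \<le> kb"
    and r [measurable]: "r \<in> borel_measurable N"
    and r_bounds: "\<And>x. x \<in> space N \<Longrightarrow> 0 \<le> r x \<and> r x \<le> rb"
    and \<gamma> [measurable]: "\<gamma> \<in> borel_measurable N"
    and \<gamma>_bound: "\<And>x. x \<in> space N \<Longrightarrow> \<bar>\<gamma> x\<bar> \<le> gb"
    and weight: "\<And>l::real. 0 < l \<Longrightarrow> \<exists>\<phi>\<in>borel_measurable M. \<exists>\<Phi>::real. \<forall>x\<in>space M. 1 \<le> \<phi> x \<and> \<phi> x \<le> \<Phi> \<and>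
      (LINT y|M. indicator {..<x} y * \<phi> y) \<le> \<phi> x / l"
  obtains u F D where "u \<in> borel_measurable M" "\<And>x. x \<in> space M \<Longrightarrow> \<bar>u x\<bar> \<le> D"
    "F \<in> borel_measurable N" "\<And>x. x \<in> space N \<Longrightarrow> \<bar>F x\<bar> \<le> D"
    "\<And>x. x \<in> space M \<Longrightarrow> u x = (LINT s:{0<..x}|N. F s)"
    "\<And>s. F s = r s * (\<gamma> s + (LINT y:{..<s}|M. k y * u y))"
    "(\<forall>x\<in>space N. 0 \<le> \<gamma> x) \<longrightarrow> (\<forall>x\<in>space M. 0 \<le> u x)"
proof -
  have "0 \<in> space M" "0 \<in> space N" by (auto simp: M.space_torus N.space_torus)
  with k_bounds r_bounds \<gamma>_bound have nn: "0 \<le> kb" "0 \<le> rb" "0 \<le> gb"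
    by (meson order_trans abs_ge_zero)+
  \<comment> \<open>a bound for the kernel; with \<open>l = 2 * C + 1\<close> the contraction factor \<open>C / l\<close> is below \<open>1/2\<close>\<close>
  define C where "C = kb * (rb * measure N (space N))"
  have C: "0 \<le> C" unfolding C_def using nn by simp
  define l where "l = 2 * C + 1"
  have l: "0 < l" using C by (simp add: l_def)
  obtain \<phi> \<Phi> where \<phi> [measurable]: "\<phi> \<in> borel_measurable M"
    and \<phi>_bounds: "\<And>x. x \<in> space M \<Longrightarrow> 1 \<le> \<phi> x \<and> \<phi> x \<le> \<Phi>"
    and \<phi>_int: "\<And>x. x \<in> space M \<Longrightarrow> (LINT y|M. indicator {..<x} y * \<phi> y) \<le> \<phi> x / l"
    using weight[OF l] by auto
  define R where "R x y = (LINT s|N. indicator {y<..x} s * r s)" for x y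
  define K where "K x y = R x y * k y" for x y
  have ind_le: "\<bar>indicator A s * h\<bar> \<le> \<bar>h\<bar>" for A and s h :: real
    by (auto simp: indicator_def)
  have ir_int: "integrable N (\<lambda>s. indicator {y<..x} s * r s)" for x y
    by (rule N.integrable_bounded[of _ rb])
       (use r_bounds in \<open>auto simp: indicator_def intro: order_trans[OF _ conjunct2[OF r_bounds]] nn(2)\<close>)
  have R_bounds: "0 \<le> R x y" "R x y \<le> rb * measure N (space N)" for x y
  proof -
    show "0 \<le> R x y" unfolding R_def
      using r_bounds by (intro integral_nonneg_AE AE_I2) auto
    have "R x y \<le> (LINT s|N. rb)" unfolding R_def
      using ir_int r_bounds nn by (intro integral_mono) (auto simp: indicator_def)
    then show "R x y \<le> rb * measure N (space N)" by (simp add: mult.commute)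
  qed
  have R_0: "R x y = 0" if "\<not> y < x" for x y
    using that by (simp add: R_def)
  have MM_meas: "case_prod K \<in> borel_measurable (M \<Otimes>\<^sub>M M)"
  proof -
    have 1: "(\<lambda>z. fst z) \<in> borel_measurable (M \<Otimes>\<^sub>M M)"
      using measurable_compose[OF measurable_fst M.ident_measurable] by simp
    have 2: "(\<lambda>z. snd z) \<in> borel_measurable (M \<Otimes>\<^sub>M M)"
      using measurable_compose[OF measurable_snd M.ident_measurable] by simp
    note [measurable] = 1 2
    have "(\<lambda>z. LINT s|N. indicator {snd z<..fst z} s * r s) \<in> borel_measurable (M \<Otimes>\<^sub>M M)"
    proof (rule N.borel_measurable_lebesgue_integral)
      have 3: "(\<lambda>z. fst (fst z)) \<in> borel_measurable ((M \<Otimes>\<^sub>M M) \<Otimes>\<^sub>M N)"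
        "(\<lambda>z. snd (fst z)) \<in> borel_measurable ((M \<Otimes>\<^sub>M M) \<Otimes>\<^sub>M N)"
        using measurable_compose[OF measurable_fst 1] measurable_compose[OF measurable_fst 2] by auto
      have 4: "(\<lambda>z. snd z) \<in> borel_measurable ((M \<Otimes>\<^sub>M M) \<Otimes>\<^sub>M N)"
        using measurable_compose[OF measurable_snd N.ident_measurable] by simp
      note [measurable] = 3 4
      show "(\<lambda>(z, s). indicator {snd z<..fst z} s * r s) \<in> borel_measurable ((M \<Otimes>\<^sub>M M) \<Otimes>\<^sub>M N)"
        unfolding case_prod_beta' by measurable
    qed
    then show ?thesis
      unfolding K_def R_def case_prod_beta' by measurable
  qed
  have K_bounds: "0 \<le> K x y \<and> K x y \<le> C" if "y \<in> space M" for x y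
    using k_bounds[OF that] R_bounds[of x y] nn
    by (auto simp: K_def C_def mult.commute[of kb] intro!: mult_mono)
  have contr: "(LINT y|M. K x y * \<phi> y) \<le> (C / l) * \<phi> x" if x: "x \<in> space M" for x
  proof -
    have "(LINT y|M. K x y * \<phi> y) \<le> (LINT y|M. C * (indicator {..<x} y * \<phi> y))"
    proof (rule integral_mono)
      have "case_prod K \<in> borel_measurable (M \<Otimes>\<^sub>M M)" by (rule MM_meas)
      from measurable_compose[OF measurable_Pair1'[OF x] this]
      have [measurable]: "K x \<in> borel_measurable M" by simp
      show "integrable M (\<lambda>y. K x y * \<phi> y)"
      proof (rule M.integrable_bounded[of _ "C * \<Phi>"])
        fix y assume y: "y \<in> space M"
        have "0 \<le> \<phi> y" using \<phi>_bounds[OF y] by simp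
        then show "\<bar>K x y * \<phi> y\<bar> \<le> C * \<Phi>"
          using K_bounds[OF y, of x] \<phi>_bounds[OF y] C by (auto simp: abs_mult intro!: mult_mono)
      qed simp
      have "integrable M (\<lambda>y. indicator {..<x} y * \<phi> y)"
        by (rule M.integrable_bounded[of _ \<Phi>])
           (use \<phi>_bounds in \<open>force simp: indicator_def\<close>)+
      then show "integrable M (\<lambda>y. C * (indicator {..<x} y * \<phi> y))" by simp
      fix y assume y: "y \<in> space M"
      show "K x y * \<phi> y \<le> C * (indicator {..<x} y * \<phi> y)"
        using K_bounds[OF y, of x] \<phi>_bounds[OF y]
        by (cases "y < x") (auto simp: K_def R_0 intro!: mult_right_mono)
    qed
    also have "\<dots> \<le> C * (\<phi> x / l)"
      using mult_left_mono[OF \<phi>_int[OF x] C] by simp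
    finally show ?thesis by simp
  qed
  define f where "f x = (LINT s|N. indicator {0<..x} s * (r s * \<gamma> s))" for x
  have rg_bound: "\<bar>r s * \<gamma> s\<bar> \<le> rb * gb" if "s \<in> space N" for s
    using r_bounds[OF that] \<gamma>_bound[OF that] nn by (auto simp: abs_mult intro!: mult_mono)
  have rg_int: "integrable N (\<lambda>s. indicator {0<..x} s * (r s * \<gamma> s))" for x
    by (rule N.integrable_bounded[OF _ order_trans[OF ind_le rg_bound]]) simp_all
  have f_meas: "f \<in> borel_measurable M"
    unfolding f_def[abs_def]
    by (rule N.borel_measurable_lebesgue_integral) (unfold case_prod_beta', measurable)
  define c where "c = rb * gb * measure N (space N)"
  have c: "0 \<le> c" using nn by (simp add: c_def)
  have f_bound: "\<bar>f x\<bar> \<le> c * \<phi> x" if x: "x \<in> space M" for x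
  proof -
    have "\<bar>f x\<bar> \<le> (LINT s|N. \<bar>indicator {0<..x} s * (r s * \<gamma> s)\<bar>)"
      unfolding f_def by (rule integral_abs_bound)
    also have "\<dots> \<le> (LINT s|N. rb * gb)"
      using rg_int[of x] by (intro integral_mono integrable_abs order_trans[OF ind_le rg_bound]) simp_all
    also have "\<dots> = c * 1" by (simp add: c_def mult.commute)
    also have "\<dots> \<le> c * \<phi> x" using \<phi>_bounds[OF x] c by (intro mult_left_mono) auto
    finally show ?thesis .
  qed
  have q: "0 \<le> C / l" "C / l < 1" using C by (auto simp: l_def field_simps)
  have \<phi>_bounds': "0 \<le> \<phi> x \<and> \<phi> x \<le> \<Phi>" if "x \<in> space M" for x
    using \<phi>_bounds[OF that] by simp
  obtain u D where u [measurable]: "u \<in> borel_measurable M"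
    and u_bound: "\<And>x. x \<in> space M \<Longrightarrow> \<bar>u x\<bar> \<le> D"
    and u_eq: "\<And>x. x \<in> space M \<Longrightarrow> u x = f x + (LINT y|M. K x y * u y)"
    and u_nonneg: "(\<forall>x\<in>space M. 0 \<le> f x) \<longrightarrow> (\<forall>x\<in>space M. 0 \<le> u x)"
    by (rule M.Neumann_series[OF MM_meas f_meas \<phi> K_bounds \<phi>_bounds' f_bound c q contr]) blast+
  have D: "0 \<le> D" using u_bound[OF \<open>0 \<in> space M\<close>] by linarith
  define p where "p y = k y * u y" for y
  have p_meas [measurable]: "p \<in> borel_measurable M" unfolding p_def by measurable
  have p_bound: "\<bar>p y\<bar> \<le> kb * D" if "y \<in> space M" for y
    using k_bounds[OF that] u_bound[OF that] nn D by (auto simp: p_def abs_mult intro!: mult_mono)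
  have p_int: "integrable M (\<lambda>y. indicator {..<s} y * p y)" for s
    by (rule M.integrable_bounded[OF _ order_trans[OF ind_le p_bound]]) simp_all
  define Q where "Q s = (LINT y|M. indicator {..<s} y * p y)" for s
  have Q_meas [measurable]: "Q \<in> borel_measurable N"
    unfolding Q_def[abs_def]
    by (rule M.borel_measurable_lebesgue_integral) 
       (unfold case_prod_beta', intro borel_measurable_times borel_measurable_indicator_lessThan
         measurable_compose[OF measurable_snd p_meas] measurable_compose[OF measurable_fst N.ident_measurable]
         measurable_compose[OF measurable_snd M.ident_measurable])
  have Q_bound: "\<bar>Q s\<bar> \<le> kb * D * measure M (space M)" for s
  proof -
    have "\<bar>Q s\<bar> \<le> (LINT y|M. \<bar>indicator {..<s} y * p y\<bar>)"
      unfolding Q_def by (rule integral_abs_bound)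
    also have "\<dots> \<le> (LINT y|M. kb * D)"
      using p_int by (intro integral_mono integrable_abs order_trans[OF ind_le p_bound]) simp_all
    finally show ?thesis by (simp add: mult_ac)
  qed
  define F where "F s = r s * (\<gamma> s + Q s)" for s
  have F_meas: "F \<in> borel_measurable N" unfolding F_def by measurable
  have F_bound: "\<bar>F s\<bar> \<le> rb * (gb + kb * D * measure M (space M))" if "s \<in> space N" for s
    unfolding F_def abs_mult using r_bounds[OF that] \<gamma>_bound[OF that] Q_bound[of s] nn
    by (intro mult_mono) auto
  have rQ_int: "integrable N (\<lambda>s. indicator {0<..x} s * (r s * Q s))" for x
  proof (rule N.integrable_bounded[of _ "rb * (kb * D * measure M (space M))"])
    fix s assume s: "s \<in> space N"
    have "\<bar>r s * Q s\<bar> \<le> rb * (kb * D * measure M (space M))"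
      unfolding abs_mult using r_bounds[OF s] Q_bound[of s] nn by (intro mult_mono) auto
    then show "\<bar>indicator {0<..x} s * (r s * Q s)\<bar> \<le> rb * (kb * D * measure M (space M))"
      by (rule order_trans[OF ind_le])
  qed measurable
  have u_F: "u x = (LINT s:{0<..x}|N. F s)" if x: "x \<in> space M" for x
  proof -
    define h where "h y s = indicator {0<..x} s * (indicator {..<s} y * (r s * p y))" for y s
    have "integrable (M \<Otimes>\<^sub>M N) (case_prod h)"
    proof (rule P.integrable_const_bound[of _ "rb * (kb * D)"])
      show "case_prod h \<in> borel_measurable (M \<Otimes>\<^sub>M N)"
        unfolding h_def case_prod_beta' by measurable
      have "\<bar>h y s\<bar> \<le> rb * (kb * D)" if "y \<in> space M" "s \<in> space N" for y s
      proof -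
        have "\<bar>h y s\<bar> \<le> \<bar>r s * p y\<bar>" unfolding h_def by (auto simp: indicator_def)
        also have "\<dots> \<le> rb * (kb * D)"
          unfolding abs_mult using r_bounds[OF that(2)] p_bound[OF that(1)] nn by (intro mult_mono) auto
        finally show ?thesis .
      qed
      then show "AE z in M \<Otimes>\<^sub>M N. norm (case_prod h z) \<le> rb * (kb * D)"
        by (intro AE_I2) (auto simp: space_pair_measure)
    qed
    from Fubini_integral[OF this]
    have swap: "(LINT s|N. LINT y|M. h y s) = (LINT y|M. LINT s|N. h y s)" .
    have "(LINT y|M. K x y * u y) = (LINT y|M. LINT s|N. h y s)"
    proof (rule Bochner_Integration.integral_cong[OF refl])
      fix y assume "y \<in> space M"
      then have y: "0 \<le> y" by (simp add: M.space_torus)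
      have "(LINT s|N. h y s) = (LINT s|N. (indicator {y<..x} s * r s) * p y)"
        using y by (intro Bochner_Integration.integral_cong) (auto simp: h_def indicator_def)
      then show "K x y * u y = (LINT s|N. h y s)"
        by (simp add: K_def R_def p_def)
    qed
    also have "\<dots> = (LINT s|N. LINT y|M. h y s)" by (rule swap[symmetric])
    also have "\<dots> = (LINT s|N. indicator {0<..x} s * (r s * Q s))"
    proof (rule Bochner_Integration.integral_cong[OF refl])
      fix s
      have "(LINT y|M. h y s) =
          (LINT y|M. (indicator {0<..x} s * r s) * (indicator {..<s} y * p y))"
        unfolding h_def by (intro Bochner_Integration.integral_cong refl) (simp only: mult_ac)
      then show "(LINT y|M. h y s) = indicator {0<..x} s * (r s * Q s)"
        by (simp add: Q_def mult.assoc)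
    qed
    finally have "u x = (LINT s|N. indicator {0<..x} s * (r s * \<gamma> s) + indicator {0<..x} s * (r s * Q s))"
      using u_eq[OF x] rg_int rQ_int by (simp add: f_def)
    also have "\<dots> = (LINT s:{0<..x}|N. F s)"
      unfolding set_lebesgue_integral_def F_def
      by (intro Bochner_Integration.integral_cong) (auto simp: algebra_simps)
    finally show ?thesis .
  qed
  let ?D = "max D (rb * (gb + kb * D * measure M (space M)))"
  show ?thesis
  proof (rule that[of u ?D F])
    show "u \<in> borel_measurable M" "F \<in> borel_measurable N" by fact+
    show "\<bar>u x\<bar> \<le> ?D" if "x \<in> space M" for x using u_bound[OF that] by simp
    show "\<bar>F x\<bar> \<le> ?D" if "x \<in> space N" for x using F_bound[OF that] by simp
    show "u x = (LINT s:{0<..x}|N. F s)" if "x \<in> space M" for x by (rule u_F[OF that])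
    show "F s = r s * (\<gamma> s + (LINT y:{..<s}|M. k y * u y))" for s
      by (simp add: F_def Q_def p_def set_lebesgue_integral_def)
    show "(\<forall>x\<in>space N. 0 \<le> \<gamma> x) \<longrightarrow> (\<forall>x\<in>space M. 0 \<le> u x)"
    proof
      assume "\<forall>x\<in>space N. 0 \<le> \<gamma> x"
      then have "0 \<le> f z" for z
        unfolding f_def using r_bounds by (intro integral_nonneg_AE AE_I2) auto
      then show "\<forall>x\<in>space M. 0 \<le> u x" using u_nonneg by blast
    qed
  qed
qed

end

section \<open>Existence and uniqueness for a fixed path\<close>

lemma (in torus_measure) integrable_bounded_mult:
  fixes b f :: "real \<Rightarrow> real"
  assumes "b \<in> borel_measurable M" "\<And>x. x \<in> space M \<Longrightarrow> \<bar>b x\<bar> \<le> C" "integrable M f"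
  shows "integrable M (\<lambda>x. b x * f x)"
proof (rule Bochner_Integration.integrable_bound)
  show "integrable M (\<lambda>x. C * \<bar>f x\<bar>)" using assms(3) by simp
  show "(\<lambda>x. b x * f x) \<in> borel_measurable M" using assms by simp
  show "AE x in M. norm (b x * f x) \<le> norm (C * \<bar>f x\<bar>)"
  proof (rule AE_I2)
    fix x assume "x \<in> space M"
    then have "\<bar>b x\<bar> * \<bar>f x\<bar> \<le> C * \<bar>f x\<bar>" by (intro mult_right_mono assms(2)) auto
    then show "norm (b x * f x) \<le> norm (C * \<bar>f x\<bar>)"
      unfolding real_norm_def abs_mult[of "b x"] by (rule order_trans[OF _ abs_ge_self])
  qed
qed

lemma periodic_eq_frac:
  fixes x :: real
  assumes "periodic_fun_simple' u"
  shows "u x = u (frac x)"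
proof -
  interpret periodic_fun_simple' u by (rule assms)
  show ?thesis using minus_of_int[of x "\<lfloor>x\<rfloor>"] by (simp add: frac_def)
qed

lemma periodic_fun_frac: "periodic_fun_simple' (\<lambda>x::real. u (frac x))"
  by standard (simp add: frac_1_eq)

text \<open>
  The Dirichlet condition at \<open>0\<close> removes the constant of integration.
\<close>

lemma HWVD_primitive:
  assumes "g \<in> HWVD W V"
  shows "DW W g \<in> L2W0 W"
    and "\<And>x. 0 \<le> x \<Longrightarrow> x < 1 \<Longrightarrow> g x = (LINT s:{0<..x}|dW W. DW W g s)"
proof -
  have ex: "\<exists>F. has_W_deriv W g F" and g0: "g 0 = 0"
    using assms by (auto simp: HWVD_def HWV_def)
  have D: "has_W_deriv W g (DW W g)"
    unfolding DW_def by (rule someI_ex[OF ex])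
  then show "DW W g \<in> L2W0 W" by (simp add: has_W_deriv_def)
  from D obtain c where c: "\<And>x. x \<in> {0..<1} \<Longrightarrow> g x = c + (LINT s:{0<..x}|dW W. DW W g s)"
    unfolding has_W_deriv_def by blast
  have "c = 0" using c[of 0] g0 by (simp add: set_lebesgue_integral_def)
  then show "g x = (LINT s:{0<..x}|dW W. DW W g s)" if "0 \<le> x" "x < 1" for x
    using c[of x] that by simp
qed

lemma HWVD_cadlag:
  assumes W: "strict_mono W" "cadlag_on UNIV W" and u: "u \<in> HWVD W V"
  shows "cadlag_on UNIV u"
proof -
  interpret N: torus_measure "dW W" using W by (rule torus_measure_dW)
  show ?thesis
  proof (rule N.periodic_primitive_cadlag[of "DW W u" u 0])
    show "integrable (dW W) (DW W u)"
      using HWVD_primitive(1)[OF u] by (intro N.L2_integrable) (simp add: L2W0_def)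
    show "periodic_fun_simple' u" using u by (simp add: HWVD_def HWV_def)
  qed (simp add: HWVD_primitive(2)[OF u])
qed

lemma L2W0_D:
  assumes "F \<in> L2W0 W"
  shows "F \<in> L2 (dW W)" and "(LINT s|dW W. F s) = 0"
  using assms by (simp_all add: L2W0_def)

lemma DW_unique:
  assumes W: "strict_mono W" "cadlag_on UNIV W" "isCont W 0"
    and u: "u \<in> HWVD W V" and F: "F \<in> L2W0 W"
    and prim: "\<And>x. 0 \<le> x \<Longrightarrow> x < 1 \<Longrightarrow> u x = (LINT s:{0<..x}|dW W. F s)"
  shows "AE s in dW W. DW W u s = F s"
proof -
  interpret N: torus_measure "dW W" using W(1,2) by (rule torus_measure_dW)
  note D = L2W0_D[OF HWVD_primitive(1)[OF u]] and F' = L2W0_D[OF F]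
  show ?thesis
  proof (rule N.AE_eq_if_primitives_eq[OF dW_no_atom_0[OF W]
        N.L2_integrable[OF D(1)] N.L2_integrable[OF F'(1)]])
    show "(LINT s|dW W. DW W u s) = (LINT s|dW W. F s)"
      by (simp only: D(2) F'(2))
    show "(LINT s:{0<..x}|dW W. DW W u s) = (LINT s:{0<..x}|dW W. F s)" if "0 \<le> x" "x < 1" for x
      by (simp only: HWVD_primitive(2)[OF u that, symmetric] prim[OF that])
  qed
qed

locale elliptic_problem =
  fixes W V \<kappa> H :: "real \<Rightarrow> real"
  assumes W: "strict_mono W" "cadlag_on UNIV W" "isCont W 0"
    and V: "strict_mono V" "caglad_on UNIV V" "V 0 = 0"
    and \<kappa>: "\<kappa> \<in> borel_measurable borel" "bounded (range \<kappa>)"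
    and H: "H \<in> borel_measurable borel" "bounded (range H)" "bounded_away_from_zero H"
      "\<And>x. 0 < H x"
begin

sublocale torus_measure_pair "dV V" "dW W"
  by (intro torus_measure_pair.intro torus_measure_dV torus_measure_dW W V)

lemma no_atom: "emeasure (dW W) {0} = 0"
  by (rule dW_no_atom_0[OF W])

lemma coefficient_bounds:
  obtains kb Hl Hb where "\<And>x. (\<kappa> x)\<^sup>2 \<le> kb" "0 < Hl" "\<And>x. Hl \<le> H x" "\<And>x. H x \<le> Hb"
proof -
  obtain k0 where k0: "\<And>x. \<bar>\<kappa> x\<bar> \<le> k0" using \<kappa>(2) by (auto simp: bounded_iff)
  obtain Hb where Hb: "\<And>x. \<bar>H x\<bar> \<le> Hb" using H(2) by (auto simp: bounded_iff)
  obtain Hl where Hl: "0 < Hl" "\<And>x. Hl \<le> \<bar>H x\<bar>"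
    using H(3) by (auto simp: bounded_away_from_zero_def)
  show ?thesis
  proof (rule that[of "k0\<^sup>2" Hl Hb])
    show "(\<kappa> x)\<^sup>2 \<le> k0\<^sup>2" for x using power_mono[OF k0[of x], of 2] by simp
    show "Hl \<le> H x" for x using Hl(2)[of x] H(4)[of x] by simp
    show "H x \<le> Hb" for x using Hb[of x] by simp
  qed (rule Hl)
qed

lemma \<kappa>_sq_measurable [measurable]: "(\<lambda>x. (\<kappa> x)\<^sup>2) \<in> borel_measurable (dV V)"
  using \<kappa>(1) by (intro M.borel_imp_measurable) simp

lemma H_measurable [measurable]: "H \<in> borel_measurable (dW W)"
  using H(1) by (rule N.borel_imp_measurable)

lemma form_integrable:
  assumes "u \<in> HWVD W V" "g \<in> HWVD W V"
  shows "integrable (dV V) (\<lambda>x. (\<kappa> x)\<^sup>2 * (u x * g x))"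
    and "integrable (dW W) (\<lambda>x. H x * (DW W u x * DW W g x))"
proof -
  obtain kb Hl Hb where b: "\<And>x. (\<kappa> x)\<^sup>2 \<le> kb" "0 < Hl" "\<And>x. Hl \<le> H x" "\<And>x. H x \<le> Hb"
    by (rule coefficient_bounds) blast
  show "integrable (dV V) (\<lambda>x. (\<kappa> x)\<^sup>2 * (u x * g x))"
    using assms b(1)
    by (intro M.integrable_bounded_mult[of _ kb] M.L2_mult_integrable) (auto simp: HWVD_def HWV_def)
  show "integrable (dW W) (\<lambda>x. H x * (DW W u x * DW W g x))"
    using assms[THEN HWVD_primitive(1)] b(4) less_imp_le[OF H(4)]
    by (intro N.integrable_bounded_mult[of _ Hb] N.L2_mult_integrable) (auto simp: L2W0_def)
qed

text \<open>
  The difference \<open>u - v\<close> has zero energy. Testing with \<open>u\<close> and \<open>v\<close> separately gives this by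
  bilinearity and avoids forming the difference inside the energetic space.
\<close>

lemma weak_solution_unique:
  assumes u: "weak_solution W V \<kappa> H \<phi> u" and v: "weak_solution W V \<kappa> H \<phi> v"
  shows "u = v"
proof -
  let ?a = "\<lambda>f g. (LINT x|dV V. (\<kappa> x)\<^sup>2 * (f x * g x)) +
      (LINT x|dW W. H x * (DW W f x * DW W g x))"
  have uH: "u \<in> HWVD W V" and vH: "v \<in> HWVD W V"
    using u v by (auto simp: weak_solution_def)
  have "?a u u = \<phi> u" "?a v u = \<phi> u" "?a u v = \<phi> v" "?a v v = \<phi> v"
    using u v uH vH by (auto simp: weak_solution_def mult.assoc)
  then have "?a u u - ?a v u - ?a u v + ?a v v = 0" by simp
  also have "?a u u - ?a v u - ?a u v + ?a v v =
      (LINT x|dV V. (\<kappa> x)\<^sup>2 * (u x - v x)\<^sup>2) + (LINT x|dW W. H x * (DW W u x - DW W v x)\<^sup>2)"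
  proof -
    note int = form_integrable[OF uH uH] form_integrable[OF vH uH]
      form_integrable[OF uH vH] form_integrable[OF vH vH]
    have 1: "(\<lambda>x. (\<kappa> x)\<^sup>2 * (u x - v x)\<^sup>2) = (\<lambda>x. (\<kappa> x)\<^sup>2 * (u x * u x) -
        (\<kappa> x)\<^sup>2 * (v x * u x) - (\<kappa> x)\<^sup>2 * (u x * v x) + (\<kappa> x)\<^sup>2 * (v x * v x))"
      by (simp add: fun_eq_iff power2_diff power2_eq_square algebra_simps)
    have 2: "(\<lambda>x. H x * (DW W u x - DW W v x)\<^sup>2) = (\<lambda>x. H x * (DW W u x * DW W u x) -
        H x * (DW W v x * DW W u x) - H x * (DW W u x * DW W v x) + H x * (DW W v x * DW W v x))"
      by (simp add: fun_eq_iff power2_eq_square algebra_simps)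
    have "(LINT x|dV V. (\<kappa> x)\<^sup>2 * (u x - v x)\<^sup>2) =
        (LINT x|dV V. (\<kappa> x)\<^sup>2 * (u x * u x)) - (LINT x|dV V. (\<kappa> x)\<^sup>2 * (v x * u x)) -
        (LINT x|dV V. (\<kappa> x)\<^sup>2 * (u x * v x)) + (LINT x|dV V. (\<kappa> x)\<^sup>2 * (v x * v x))"
      unfolding 1 by (simp only: int Bochner_Integration.integral_add Bochner_Integration.integral_diff
        Bochner_Integration.integrable_diff)
    moreover have "(LINT x|dW W. H x * (DW W u x - DW W v x)\<^sup>2) =
        (LINT x|dW W. H x * (DW W u x * DW W u x)) - (LINT x|dW W. H x * (DW W v x * DW W u x)) -
        (LINT x|dW W. H x * (DW W u x * DW W v x)) + (LINT x|dW W. H x * (DW W v x * DW W v x))"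
      unfolding 2 by (simp only: int Bochner_Integration.integral_add Bochner_Integration.integral_diff
        Bochner_Integration.integrable_diff)
    ultimately show ?thesis by linarith
  qed
  finally have sum: "(LINT x|dV V. (\<kappa> x)\<^sup>2 * (u x - v x)\<^sup>2) +
      (LINT x|dW W. H x * (DW W u x - DW W v x)\<^sup>2) = 0" .
  have "0 \<le> (LINT x|dV V. (\<kappa> x)\<^sup>2 * (u x - v x)\<^sup>2)"
    by (intro integral_nonneg_AE AE_I2) simp
  moreover have Hnn: "0 \<le> H x * (DW W u x - DW W v x)\<^sup>2" for x
    using H(4)[of x] by simp
  then have "0 \<le> (LINT x|dW W. H x * (DW W u x - DW W v x)\<^sup>2)"
    by (intro integral_nonneg_AE AE_I2)
  ultimately have "(LINT x|dW W. H x * (DW W u x - DW W v x)\<^sup>2) = 0"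
    using sum by linarith
  moreover have "integrable (dW W) (\<lambda>x. H x * (DW W u x - DW W v x)\<^sup>2)"
  proof -
    note int = form_integrable(2)[OF uH uH] form_integrable(2)[OF vH uH]
      form_integrable(2)[OF uH vH] form_integrable(2)[OF vH vH]
    have "integrable (dW W) (\<lambda>x. H x * (DW W u x * DW W u x) -
        H x * (DW W v x * DW W u x) - H x * (DW W u x * DW W v x) + H x * (DW W v x * DW W v x))"
      using int by simp
    then show ?thesis
      by (rule Bochner_Integration.integrable_cong[THEN iffD1, rotated 2])
         (simp_all add: power2_eq_square algebra_simps)
  qed
  ultimately have "AE x in dW W. H x * (DW W u x - DW W v x)\<^sup>2 = 0"
    using Hnn by (simp add: integral_nonneg_eq_0_iff_AE)
  then have ae: "AE x in dW W. DW W u x = DW W v x"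
    by eventually_elim (use H(4) in \<open>auto simp: order_less_le\<close>)
  have meas: "DW W u \<in> borel_measurable (dW W)" "DW W v \<in> borel_measurable (dW W)"
    using HWVD_primitive(1)[OF uH] HWVD_primitive(1)[OF vH] by (auto simp: L2W0_def L2_def)
  have eq: "u x = v x" if "0 \<le> x" "x < 1" for x
    unfolding HWVD_primitive(2)[OF uH that] HWVD_primitive(2)[OF vH that]
      set_lebesgue_integral_def
    using ae meas by (intro integral_cong_AE) (auto elim!: eventually_mono)
  have "periodic_fun_simple' u" "periodic_fun_simple' v"
    using uH vH by (auto simp: HWVD_def HWV_def)
  then show "u = v"
    using eq[OF frac_ge_0 frac_lt_1] by (metis periodic_eq_frac ext)
qed

lemma exp_weight:
  fixes l :: real
  assumes "0 < l"
  shows "\<exists>\<phi>\<in>borel_measurable (dV V). \<exists>\<Phi>. \<forall>x\<in>space (dV V). 1 \<le> \<phi> x \<and> \<phi> x \<le> \<Phi> \<and>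
    (LINT y|dV V. indicator {..<x} y * \<phi> y) \<le> \<phi> x / l"
proof (intro bexI exI ballI conjI)
  show "(\<lambda>x. exp (l * V x)) \<in> borel_measurable (dV V)"
    using borel_measurable_mono[OF strict_mono_mono[OF V(1)]]
    by (intro M.borel_imp_measurable) simp
  fix x assume "x \<in> space (dV V)"
  then have x: "0 \<le> x" "x < 1" by (auto simp: M.space_torus)
  have "V 0 \<le> V x" "V x \<le> V 1" using V(1) x by (auto simp: strict_mono_less_eq)
  then show "1 \<le> exp (l * V x)" "exp (l * V x) \<le> exp (l * V 1)"
    using assms V(3) by auto
  show "(LINT y|dV V. indicator {..<x} y * exp (l * V y)) \<le> exp (l * V x) / l"
    by (rule exp_weight_dV[OF V(1,2) assms x])
qed

text \<open>
  With \<open>F\<^sub>0\<close> and \<open>F\<^sub>1\<close> from the Volterra systems for the right-hand sides \<open>-\<beta>\<close> and \<open>1\<close>, the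
  combination \<open>F\<^sub>0 + a F\<^sub>1\<close> of mean zero is the \<open>W\<close>-derivative of the solution. Positivity of \<open>H\<close>
  and \<open>\<kappa>\<^sup>2 \<ge> 0\<close> give \<open>\<integral> F\<^sub>1 dW > 0\<close>, which makes the equation for \<open>a\<close> solvable.
\<close>

lemma weak_solution_exists:
  assumes \<beta> [measurable]: "\<beta> \<in> borel_measurable (dW W)"
    and \<beta>_bound: "\<And>s. s \<in> space (dW W) \<Longrightarrow> \<bar>\<beta> s\<bar> \<le> C"
  shows "\<exists>u. weak_solution W V \<kappa> H (\<lambda>g. - (LINT s|dW W. \<beta> s * DW W g s)) u"
proof -
  obtain kb Hl Hb where kb: "\<And>x. (\<kappa> x)\<^sup>2 \<le> kb" and Hl: "0 < Hl" "\<And>x. Hl \<le> H x"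
    and Hb: "\<And>x. H x \<le> Hb"
    by (rule coefficient_bounds) blast
  define r where "r s = inverse (H s)" for s
  have r_bounds: "inverse Hb \<le> r s" "0 \<le> r s \<and> r s \<le> inverse Hl" for s
    using Hl(1) Hl(2)[of s] H(4)[of s] Hb[of s] by (auto simp: r_def intro: le_imp_inverse_le)
  have r_meas [measurable]: "r \<in> borel_measurable (dW W)"
    unfolding r_def by measurable
  have k_bounds: "0 \<le> (\<kappa> x)\<^sup>2 \<and> (\<kappa> x)\<^sup>2 \<le> kb" for x using kb by simp
  have mb: "(\<lambda>s. - \<beta> s) \<in> borel_measurable (dW W)" by measurable
  have mb_bound: "\<bar>- \<beta> s\<bar> \<le> C" if "s \<in> space (dW W)" for s using \<beta>_bound[OF that] by simp
  obtain u0 F0 D0 where u0 [measurable]: "u0 \<in> borel_measurable (dV V)"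
    and u0_bound: "\<And>x. x \<in> space (dV V) \<Longrightarrow> \<bar>u0 x\<bar> \<le> D0"
    and F0 [measurable]: "F0 \<in> borel_measurable (dW W)"
    and F0_bound: "\<And>x. x \<in> space (dW W) \<Longrightarrow> \<bar>F0 x\<bar> \<le> D0"
    and u0_eq: "\<And>x. x \<in> space (dV V) \<Longrightarrow> u0 x = (LINT s:{0<..x}|dW W. F0 s)"
    and F0_eq: "\<And>s. F0 s = r s * (- \<beta> s + (LINT y:{..<s}|dV V. (\<kappa> y)\<^sup>2 * u0 y))"
    by (rule Volterra_system[OF \<kappa>_sq_measurable k_bounds r_meas r_bounds(2) mb mb_bound exp_weight]) blast+
  obtain u1 F1 D1 where u1 [measurable]: "u1 \<in> borel_measurable (dV V)"
    and u1_bound: "\<And>x. x \<in> space (dV V) \<Longrightarrow> \<bar>u1 x\<bar> \<le> D1"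
    and F1 [measurable]: "F1 \<in> borel_measurable (dW W)"
    and F1_bound: "\<And>x. x \<in> space (dW W) \<Longrightarrow> \<bar>F1 x\<bar> \<le> D1"
    and u1_eq: "\<And>x. x \<in> space (dV V) \<Longrightarrow> u1 x = (LINT s:{0<..x}|dW W. F1 s)"
    and F1_eq: "\<And>s. F1 s = r s * (1 + (LINT y:{..<s}|dV V. (\<kappa> y)\<^sup>2 * u1 y))"
    and u1_nonneg: "\<forall>x\<in>space (dV V). 0 \<le> u1 x"
    by (rule Volterra_system[OF \<kappa>_sq_measurable k_bounds r_meas r_bounds(2) _ _ exp_weight,
          of "\<lambda>_. 1" 1]) auto
  have F_int: "integrable (dW W) F0" "integrable (dW W) F1"
    by (auto intro: N.integrable_bounded[OF F0 F0_bound] N.integrable_bounded[OF F1 F1_bound])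
  have F1_ge: "inverse Hb \<le> F1 s" for s
  proof -
    have "0 \<le> (LINT y:{..<s}|dV V. (\<kappa> y)\<^sup>2 * u1 y)"
      unfolding set_lebesgue_integral_def using u1_nonneg by (intro integral_nonneg_AE AE_I2) simp
    then have "r s * 1 \<le> F1 s"
      unfolding F1_eq using r_bounds(2)[of s] by (intro mult_left_mono) auto
    then show ?thesis using r_bounds(1)[of s] by simp
  qed
  have "0 < (LINT s|dW W. F1 s)"
  proof -
    have "emeasure (dW W) {0<..1/2} \<noteq> 0"
      using emeasure_dW[OF W(1,2), of 0 "1/2"] strict_monoD[OF W(1), of 0 "1/2"]
      by (simp add: ennreal_eq_0_iff not_le)
    moreover have "emeasure (dW W) {0<..1/2} \<le> emeasure (dW W) (space (dW W))"
      by (rule emeasure_space)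
    ultimately have "emeasure (dW W) (space (dW W)) \<noteq> 0" by auto
    then have "0 < measure (dW W) (space (dW W))"
      by (simp add: N.emeasure_eq_measure zero_less_measure_iff)
    moreover have "0 < Hb" using H(4)[of 0] Hb[of 0] by linarith
    ultimately have "0 < measure (dW W) (space (dW W)) * inverse Hb" by simp
    also have "\<dots> = (LINT s|dW W. inverse Hb)" by simp
    also have "\<dots> \<le> (LINT s|dW W. F1 s)"
      using F_int F1_ge by (intro integral_mono) auto
    finally show ?thesis .
  qed
  note F1_pos = this
  \<comment> \<open>the unique value for which \<open>F\<close> has mean zero\<close>
  define a where "a = - (LINT s|dW W. F0 s) / (LINT s|dW W. F1 s)"
  define F where "F s = F0 s + a * F1 s" for s
  define u where "u x = u0 (frac x) + a * u1 (frac x)" for x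
  have u_in: "u x = u0 x + a * u1 x" if "x \<in> space (dV V)" for x
    using that by (simp add: u_def M.space_torus frac_eq)
  have F_meas [measurable]: "F \<in> borel_measurable (dW W)" unfolding F_def by measurable
  have u_meas [measurable]: "u \<in> borel_measurable (dV V)"
  proof -
    have "(\<lambda>x. u0 x + a * u1 x) \<in> borel_measurable (dV V)" by measurable
    then show ?thesis using measurable_cong[of "dV V" u "\<lambda>x. u0 x + a * u1 x" borel] u_in by blast
  qed
  have u_bound: "\<bar>u x\<bar> \<le> D0 + \<bar>a\<bar> * D1" if "x \<in> space (dV V)" for x
    unfolding u_in[OF that] using u0_bound[OF that] mult_left_mono[OF u1_bound[OF that], of "\<bar>a\<bar>"]
    by (intro order_trans[OF abs_triangle_ineq] add_mono) (auto simp: abs_mult)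
  have F_bound: "\<bar>F x\<bar> \<le> D0 + \<bar>a\<bar> * D1" if "x \<in> space (dW W)" for x
    unfolding F_def using F0_bound[OF that] mult_left_mono[OF F1_bound[OF that], of "\<bar>a\<bar>"]
    by (intro order_trans[OF abs_triangle_ineq] add_mono) (auto simp: abs_mult)
  have F_total: "(LINT s|dW W. F s) = 0"
    unfolding F_def using F_int F1_pos by (simp add: a_def)
  have F_L2W0: "F \<in> L2W0 W"
    using N.bounded_imp_L2[OF F_meas F_bound] F_total by (simp add: L2W0_def)
  have set_int: "integrable (dW W) (\<lambda>s. indicator {0<..x} s * f s)"
    if "integrable (dW W) f" for f :: "real \<Rightarrow> real" and x
    using that by (intro Bochner_Integration.integrable_bound[OF that]) (auto simp: indicator_def)
  have u_prim: "u x = (LINT s:{0<..x}|dW W. F s)" if "0 \<le> x" "x < 1" for x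
  proof -
    have x: "x \<in> space (dV V)" using that by (simp add: M.space_torus)
    have "(LINT s:{0<..x}|dW W. F s) =
        (LINT s|dW W. indicator {0<..x} s * F0 s + a * (indicator {0<..x} s * F1 s))"
      unfolding set_lebesgue_integral_def F_def
      by (intro Bochner_Integration.integral_cong) (auto simp: algebra_simps)
    also have "\<dots> = u0 x + a * u1 x"
      using set_int[OF F_int(1)] set_int[OF F_int(2)] u0_eq[OF x] u1_eq[OF x]
      by (simp add: set_lebesgue_integral_def)
    finally show ?thesis using u_in[OF x] by simp
  qed
  have uH: "u \<in> HWVD W V"
  proof -
    have "has_W_deriv W u F"
      unfolding has_W_deriv_def using F_L2W0 u_prim by (intro conjI exI[of _ 0]) auto
    moreover have "periodic_fun_simple' u"
      unfolding u_def by (rule periodic_fun_frac[of "\<lambda>y. u0 y + a * u1 y"])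
    moreover have "u 0 = 0" using u_prim[of 0] by (simp add: set_lebesgue_integral_def)
    ultimately show ?thesis
      using M.bounded_imp_L2[OF u_meas u_bound] by (auto simp: HWVD_def HWV_def)
  qed
  define p where "p x = (\<kappa> x)\<^sup>2 * u x" for x
  have p_meas [measurable]: "p \<in> borel_measurable (dV V)" unfolding p_def by measurable
  have p_bound: "\<bar>p x\<bar> \<le> kb * (D0 + \<bar>a\<bar> * D1)" if "x \<in> space (dV V)" for x
    unfolding p_def abs_mult
    using k_bounds[of x] u_bound[OF that] order_trans[OF zero_le_power2 kb[of x]]
    by (intro mult_mono) auto
  define q where "q s = (LINT y:{..<s}|dV V. p y)" for s
  \<comment> \<open>the first integral of the equation\<close>
  have HF: "H s * F s = a - \<beta> s + q s" for s
  proof -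
    have int: "integrable (dV V) (\<lambda>y. indicator {..<s} y * ((\<kappa> y)\<^sup>2 * v y))"
      if "v \<in> borel_measurable (dV V)" "\<And>x. x \<in> space (dV V) \<Longrightarrow> \<bar>v x\<bar> \<le> D" for v D
    proof -
      have "integrable (dV V) (\<lambda>y. (\<kappa> y)\<^sup>2 * v y)"
        using kb that by (intro M.integrable_bounded_mult[of _ kb] M.integrable_bounded[of _ D]) auto
      then show ?thesis
        by (rule Bochner_Integration.integrable_bound) (use that in \<open>auto simp: indicator_def\<close>)
    qed
    have "q s = (LINT y|dV V. indicator {..<s} y * ((\<kappa> y)\<^sup>2 * u0 y) +
        a * (indicator {..<s} y * ((\<kappa> y)\<^sup>2 * u1 y)))"
      unfolding q_def set_lebesgue_integral_def p_def
      by (intro Bochner_Integration.integral_cong) (auto simp: u_in algebra_simps)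
    also have "\<dots> = (LINT y:{..<s}|dV V. (\<kappa> y)\<^sup>2 * u0 y) + a * (LINT y:{..<s}|dV V. (\<kappa> y)\<^sup>2 * u1 y)"
      using int[OF u0 u0_bound] int[OF u1 u1_bound] by (simp add: set_lebesgue_integral_def)
    finally have q: "q s = \<dots>" .
    have Hr: "H s * r s = 1" using H(4)[of s] by (simp add: r_def)
    have "H s * F s = (H s * r s) * (- \<beta> s + (LINT y:{..<s}|dV V. (\<kappa> y)\<^sup>2 * u0 y)) +
        a * ((H s * r s) * (1 + (LINT y:{..<s}|dV V. (\<kappa> y)\<^sup>2 * u1 y)))"
      unfolding F_def F0_eq F1_eq by (simp only: distrib_left mult_ac)
    then show ?thesis by (simp add: q Hr algebra_simps)
  qed
  have DWu: "AE s in dW W. DW W u s = F s"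
    by (rule DW_unique[OF W uH F_L2W0 u_prim])
  have "(LINT x|dV V. (\<kappa> x)\<^sup>2 * u x * g x) + (LINT x|dW W. H x * DW W u x * DW W g x) =
      - (LINT s|dW W. \<beta> s * DW W g s)" if gH: "g \<in> HWVD W V" for g
  proof -
    define G where "G = DW W g"
    have G: "integrable (dW W) G" and G_total: "(LINT s|dW W. G s) = 0"
      using HWVD_primitive(1)[OF gH] by (auto simp: G_def L2W0_def intro: N.L2_integrable)
    have [measurable]: "G \<in> borel_measurable (dW W)" using G by simp
    have [measurable]: "DW W u \<in> borel_measurable (dW W)"
      using HWVD_primitive(1)[OF uH] by (simp add: L2W0_def L2_def)
    have bG: "integrable (dW W) (\<lambda>s. \<beta> s * G s)"
      by (rule N.integrable_bounded_mult[OF \<beta> \<beta>_bound G])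
    have HFG: "integrable (dW W) (\<lambda>s. (H s * F s) * G s)"
    proof (rule N.integrable_bounded_mult[of _ "Hb * (D0 + \<bar>a\<bar> * D1)", OF _ _ G])
      fix s assume "s \<in> space (dW W)"
      then show "\<bar>H s * F s\<bar> \<le> Hb * (D0 + \<bar>a\<bar> * D1)"
        unfolding abs_mult using F_bound Hb[of s] H(4)[of s] by (intro mult_mono) auto
    qed measurable
    define P where "P = (LINT x|dV V. p x)"
    have "(LINT x|dV V. (\<kappa> x)\<^sup>2 * u x * g x) = (LINT x|dV V. p x * (LINT s:{0<..x}|dW W. G s))"
      using HWVD_primitive(2)[OF gH]
      by (intro Bochner_Integration.integral_cong) (auto simp: p_def G_def M.space_torus)
    also have "\<dots> = (LINT s|dW W. (P - q s) * G s)"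
      unfolding P_def q_def by (rule integral_mult_primitive[OF no_atom p_meas p_bound G])
    also have "\<dots> = (LINT s|dW W. (P + a) * G s - \<beta> s * G s - (H s * F s) * G s)"
      by (intro Bochner_Integration.integral_cong refl) (simp only: HF, simp add: algebra_simps)
    also have "\<dots> = - (LINT s|dW W. \<beta> s * G s) - (LINT s|dW W. (H s * F s) * G s)"
      using G bG HFG G_total by simp
    finally have 1: "(LINT x|dV V. (\<kappa> x)\<^sup>2 * u x * g x) = \<dots>" .
    have 2: "(LINT x|dW W. H x * DW W u x * G x) = (LINT s|dW W. (H s * F s) * G s)"
      using DWu by (intro integral_cong_AE) (auto elim!: eventually_mono)
    show ?thesis using 1 2 by (simp add: G_def)
  qed
  then show ?thesis using uH unfolding weak_solution_def by blast
qed

end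

theorem theorem24:
  fixes W V \<kappa> H :: "real \<Rightarrow> real"
    and M :: "'a measure"
    and B :: "real \<Rightarrow> 'a \<Rightarrow> real"
  assumes "strict_mono W" and "cadlag_on UNIV W"
    and "\<And>x. W (x + 1) - W x = W 1 - W 0"
    and "isCont W 0" and "W 0 = 0"
    and "strict_mono V" and "caglad_on UNIV V"
    and "\<And>x. V (x + 1) - V x = V 1 - V 0"
    and "isCont V 0" and "V 0 = 0"
    and "periodic_fun_simple' \<kappa>" and "\<kappa> \<in> borel_measurable borel"
    and "bounded (range \<kappa>)" and "bounded_away_from_zero \<kappa>"
    and "periodic_fun_simple' H" and "H \<in> borel_measurable borel"
    and "bounded (range H)" and "bounded_away_from_zero H" and "\<And>x. H x > 0"
    and "W_brownian_motion M W B"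
  shows "AE \<omega> in M.
    (\<exists>!u. weak_solution W V \<kappa> H (white_noise W (\<lambda>t. B t \<omega>)) u) \<and>
    (\<forall>u. weak_solution W V \<kappa> H (white_noise W (\<lambda>t. B t \<omega>)) u \<longrightarrow> cadlag_on UNIV u)"
proof (rule AE_I2)
  interpret elliptic_problem W V \<kappa> H
    using assms by unfold_locales
  fix \<omega> assume "\<omega> \<in> space M"
  then have b: "cadlag_on {0..1} (\<lambda>t. B t \<omega>)"
    using assms by (simp add: W_brownian_motion_def)
  obtain C where "\<forall>s\<in>space (dW W). \<bar>Lim (at_left s) (\<lambda>t. B t \<omega>)\<bar> \<le> C"
    using N.left_limit_bounded_measurable(2)[OF b] by blast
  then have "\<exists>u. weak_solution W V \<kappa> H (white_noise W (\<lambda>t. B t \<omega>)) u"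
    using weak_solution_exists[OF N.left_limit_bounded_measurable(1)[OF b], of C]
    by (simp add: white_noise_def[abs_def])
  then show "(\<exists>!u. weak_solution W V \<kappa> H (white_noise W (\<lambda>t. B t \<omega>)) u) \<and>
      (\<forall>u. weak_solution W V \<kappa> H (white_noise W (\<lambda>t. B t \<omega>)) u \<longrightarrow> cadlag_on UNIV u)"
    using weak_solution_unique HWVD_cadlag[OF W(1,2)] by (auto simp: weak_solution_def)
qed

end
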